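(* Let $X$ be a Banach space, $A:D(A)\subset X\to X$ a Hille-Yosida operator, $X_0=\overline{D(A)}$, and let $F,V:\mathbb R\to\mathcal L(X_0,X)$ be almost periodic (in the operator norm), with the ordered-space conventions given in the context. Assume that there is $\omega\in\mathbb R$ with $(\omega,+\infty)\subset\rho(A)$ and $(\lambda I-A)^{-1}$ is a positive operator for all $\lambda>\omega$; that there exists $\lambda_1>\omega_A$ such that $\lambda_1\phi-V(t)\phi\in X_+$ for all $\phi\in X_0^+$, $t\in\mathbb R$; and that $F(t)\phi\in X_+$ for all $t\in\mathbb R$, $\phi\in X_0^+$. Then the one-parameter family $\{\mathbb U(t)\}_{t\ge0}$, defined by $[\mathbb U(t)\phi](s)=U(s,s-t)\phi(s-t)$ for $\phi\in AP(\mathbb R,X_0)$, $t\ge 0$, $s\in\mathbb R$, is a $C_0$-semigroup on the Banach space $AP(\mathbb R,X_0)$.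
   Context: Almost periodicity: for a metric space $(Y,d)$, $f\in C(\mathbb R,Y)$ is almost periodic if for every $\epsilon>0$ the set $\mathcal T(f,\epsilon)=\{\tau\in\mathbb R:d(f(t+\tau),f(t))<\epsilon\ \forall t\in\mathbb R\}$ is relatively dense (there is $l>0$ with $[c,c+l]\cap\mathcal T(f,\epsilon)\ne\emptyset$ for all $c\in\mathbb R$). $AP(\mathbb R,Y)$ is the space of such functions; for $Y$ a Banach space it is a Banach space with the supremum norm. Hille-Yosida operator: a linear operator $A$ (possibly not densely defined) for which there are $\omega_A\in\mathbb R$, $M_A\ge1$ with $(\omega_A,+\infty)\subset\rho(A)$ and $\|(\lambda I-A)^{-n}\|\le M_A(\lambda-\omega_A)^{-n}$ for all $\lambda>\omega_A$, $n\ge1$. Order: $X$ and $X_0$ have normal and generating positive cones $X_+$ and $X_0^+=X_0\cap X_+$. Evolution family: $\{U(t,s)\}_{t\ge s}$ is the exponentially bounded evolution family on $X_0$ such that $u(t)=U(t,t_0)u_0$ is the unique mild (integrated) solution of $u'(t)=Au(t)+F(t)u(t)-V(t)u(t)$, $t>t_0$, $u(t_0)=u_0\in X_0$, i.e. $u\in C([t_0,\infty),X_0)$, $\int_{t_0}^tu(s)ds\in D(A)$ and $u(t)=u_0+A\int_{t_0}^tu(s)ds+\int_{t_0}^t(F(s)-V(s))u(s)ds$. *)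

theory Defs
  imports "HOL-Analysis.Analysis"
begin

section \<open>Bounded operators on a subspace\<close>

text \<open>
  A closed subspace \<open>S\<close> of a Banach space is a set, so an operator on \<open>S\<close> is a function that is only
  meaningful on \<open>S\<close>. The elements of \<open>bounded_ops S\<close>, which stands for the space of bounded linear
  operators from \<open>S\<close> to the ambient space, are made extensional: only then is the operator-norm
  distance a metric and not just a pseudometric.
\<close>

definition linear_op_on :: "'a::real_vector set \<Rightarrow> ('a \<Rightarrow> 'b::real_vector) \<Rightarrow> bool" where
  "linear_op_on S T \<longleftrightarrow>
     (\<forall>x\<in>S. \<forall>y\<in>S. T (x + y) = T x + T y) \<and> (\<forall>c. \<forall>x\<in>S. T (c *\<^sub>R x) = c *\<^sub>R T x)"

definition bounded_linear_on :: "'a::real_normed_vector set \<Rightarrow> ('a \<Rightarrow> 'b::real_normed_vector) \<Rightarrow> bool" where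
  "bounded_linear_on S T \<longleftrightarrow> linear_op_on S T \<and> (\<exists>C. \<forall>x\<in>S. norm (T x) \<le> C * norm x)"

text \<open>Like \<^const>\<open>onorm\<close>, relying on \<open>0 / 0 = 0\<close> at the origin.\<close>

definition onorm_on :: "'a::real_normed_vector set \<Rightarrow> ('a \<Rightarrow> 'b::real_normed_vector) \<Rightarrow> real" where
  "onorm_on S T = (SUP x\<in>S. norm (T x) / norm x)"

definition bounded_ops :: "'a::real_normed_vector set \<Rightarrow> ('a \<Rightarrow> 'b::real_normed_vector) set" where
  "bounded_ops S = {T \<in> extensional S. bounded_linear_on S T}"

text \<open>The value \<open>0\<close> off the carrier only serves to satisfy the global nonnegativity in \<^locale>\<open>Metric_space\<close>.\<close>

definition op_dist :: "'a::real_normed_vector set \<Rightarrow> ('a \<Rightarrow> 'b::real_normed_vector) \<Rightarrow> ('a \<Rightarrow> 'b) \<Rightarrow> real" where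
  "op_dist S T R =
     (if T \<in> bounded_ops S \<and> R \<in> bounded_ops S then onorm_on S (\<lambda>x. T x - R x) else 0)"

definition op_metric :: "'a::real_normed_vector set \<Rightarrow> ('a \<Rightarrow> 'b::real_normed_vector) metric" where
  "op_metric S = metric (bounded_ops S, op_dist S)"

lemma bounded_linear_on_diff:
  assumes "bounded_linear_on S T" "bounded_linear_on S R"
  shows "bounded_linear_on S (\<lambda>x. T x - R x)"
proof -
  obtain C D where C: "\<forall>x\<in>S. norm (T x) \<le> C * norm x" and D: "\<forall>x\<in>S. norm (R x) \<le> D * norm x"
    using assms unfolding bounded_linear_on_def by blast
  have "norm (T x - R x) \<le> (C + D) * norm x" if "x \<in> S" for x
    using norm_triangle_ineq4[of "T x" "R x"] C D that by (fastforce simp: algebra_simps)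
  moreover have "linear_op_on S (\<lambda>x. T x - R x)"
    using assms unfolding bounded_linear_on_def linear_op_on_def by (auto simp: algebra_simps)
  ultimately show ?thesis unfolding bounded_linear_on_def by blast
qed

lemma bdd_above_onorm_on:
  assumes "bounded_linear_on S T"
  shows "bdd_above ((\<lambda>x. norm (T x) / norm x) ` S)"
proof -
  obtain C where C: "\<forall>x\<in>S. norm (T x) \<le> C * norm x"
    using assms unfolding bounded_linear_on_def by blast
  have "norm (T x) / norm x \<le> max C 0" if "x \<in> S" for x
  proof (cases "x = 0")
    case False
    then have "norm (T x) / norm x \<le> C" using C that by (simp add: divide_simps)
    then show ?thesis by simp
  qed simp
  then show ?thesis by (auto intro!: bdd_aboveI[of _ "max C 0"])
qed

lemma onorm_on_upper:
  assumes "bounded_linear_on S T" "x \<in> S"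
  shows "norm (T x) / norm x \<le> onorm_on S T"
  unfolding onorm_on_def by (rule cSUP_upper[OF assms(2) bdd_above_onorm_on[OF assms(1)]])

lemma linear_op_on_0:
  assumes "linear_op_on S T" "0 \<in> S"
  shows "T 0 = 0"
proof -
  have "T (0 *\<^sub>R 0) = 0 *\<^sub>R T 0"
    using assms unfolding linear_op_on_def by blast
  then show ?thesis by simp
qed

lemma onorm_on:
  assumes "bounded_linear_on S T" "x \<in> S"
  shows "norm (T x) \<le> onorm_on S T * norm x"
proof (cases "x = 0")
  case True
  then show ?thesis
    using assms linear_op_on_0[of S T] unfolding bounded_linear_on_def by simp
next
  case False
  then show ?thesis
    using onorm_on_upper[OF assms] by (simp add: divide_simps)
qed

lemma Metric_space_bounded_ops:
  assumes "subspace S"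
  shows "Metric_space (bounded_ops S) (op_dist S)"
proof
  have S0: "0 \<in> S" using assms by (rule subspace_0)
  show "0 \<le> op_dist S T R" for T R :: "'a \<Rightarrow> 'b"
  proof (cases "T \<in> bounded_ops S \<and> R \<in> bounded_ops S")
    case True
    then have "bounded_linear_on S (\<lambda>x. T x - R x)"
      by (intro bounded_linear_on_diff) (auto simp: bounded_ops_def)
    from onorm_on_upper[OF this S0] True show ?thesis by (simp add: op_dist_def)
  qed (auto simp: op_dist_def)
  show "op_dist S T R = op_dist S R T" for T R :: "'a \<Rightarrow> 'b"
    unfolding op_dist_def onorm_on_def by (simp add: norm_minus_commute)
  show "op_dist S T R = 0 \<longleftrightarrow> T = R" if TR: "T \<in> bounded_ops S" "R \<in> bounded_ops S"
    for T R :: "'a \<Rightarrow> 'b"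
  proof
    assume 0: "op_dist S T R = 0"
    have "bounded_linear_on S (\<lambda>x. T x - R x)"
      using TR by (intro bounded_linear_on_diff) (auto simp: bounded_ops_def)
    then have "T x = R x" if "x \<in> S" for x
      using onorm_on[of S "\<lambda>x. T x - R x" x] 0 that TR unfolding op_dist_def by simp
    then show "T = R"
      using TR by (auto simp: bounded_ops_def intro: extensionalityI)
  next
    assume "T = R"
    moreover have "S \<noteq> {}" using S0 by blast
    ultimately show "op_dist S T R = 0" by (simp add: op_dist_def onorm_on_def)
  qed
  show "op_dist S T Q \<le> op_dist S T R + op_dist S R Q"
    if "T \<in> bounded_ops S" "R \<in> bounded_ops S" "Q \<in> bounded_ops S"
    for T R Q :: "'a \<Rightarrow> 'b"
  proof -
    have "onorm_on S (\<lambda>x. T x - Q x) \<le> onorm_on S (\<lambda>x. T x - R x) + onorm_on S (\<lambda>x. R x - Q x)"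
      unfolding onorm_on_def[of S "\<lambda>x. T x - Q x"]
    proof (rule cSUP_least)
      show "S \<noteq> {}" using S0 by blast
      fix x assume x: "x \<in> S"
      have b: "bounded_linear_on S (\<lambda>x. T x - R x)" "bounded_linear_on S (\<lambda>x. R x - Q x)"
        using that by (auto simp: bounded_ops_def intro: bounded_linear_on_diff)
      have "norm (T x - Q x) \<le> norm (T x - R x) + norm (R x - Q x)"
        using norm_triangle_ineq[of "T x - R x" "R x - Q x"] by simp
      then have "norm (T x - Q x) / norm x \<le> norm (T x - R x) / norm x + norm (R x - Q x) / norm x"
        by (simp add: divide_right_mono flip: add_divide_distrib)
      also have "\<dots> \<le> onorm_on S (\<lambda>x. T x - R x) + onorm_on S (\<lambda>x. R x - Q x)"
        using onorm_on_upper[OF b(1) x] onorm_on_upper[OF b(2) x] by simp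
      finally show "norm (T x - Q x) / norm x \<le> onorm_on S (\<lambda>x. T x - R x) + onorm_on S (\<lambda>x. R x - Q x)" .
    qed
    then show ?thesis using that by (simp add: op_dist_def)
  qed
qed

lemma op_metric_simps [simp]:
  assumes "subspace S"
  shows "mspace (op_metric S) = bounded_ops S" "mdist (op_metric S) = op_dist S"
proof -
  interpret Metric_space "bounded_ops S" "op_dist S"
    by (rule Metric_space_bounded_ops[OF assms])
  show "mspace (op_metric S) = bounded_ops S" "mdist (op_metric S) = op_dist S"
    by (simp_all add: op_metric_def)
qed


section \<open>Almost periodic functions\<close>

definition relatively_dense :: "real set \<Rightarrow> bool" where
  "relatively_dense T \<longleftrightarrow> (\<exists>l>0. \<forall>c. {c..c + l} \<inter> T \<noteq> {})"

definition almost_periods :: "'b metric \<Rightarrow> (real \<Rightarrow> 'b) \<Rightarrow> real \<Rightarrow> real set" where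
  "almost_periods m f e = {\<tau>. \<forall>t. mdist m (f (t + \<tau>)) (f t) < e}"

definition almost_periodic :: "'b metric \<Rightarrow> (real \<Rightarrow> 'b) \<Rightarrow> bool" where
  "almost_periodic m f \<longleftrightarrow>
     continuous_map euclidean (mtopology_of m) f \<and>
     (\<forall>e>0. relatively_dense (almost_periods m f e))"

text \<open>
  Almost periodic functions are bounded, so \<open>AP S\<close> may be taken inside the Banach space of bounded
  continuous functions with the supremum norm; lemma \<open>apply_bcontfun_AP\<close> below shows that
  this loses no function.
\<close>

definition AP :: "'a::real_normed_vector set \<Rightarrow> (real \<Rightarrow>\<^sub>C 'a) set" where
  "AP S = {\<phi>. almost_periodic (submetric euclidean_metric S) (apply_bcontfun \<phi>)}"

lemma mtopology_of_submetric_euclidean: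
  "mtopology_of (submetric euclidean_metric S) = top_of_set S"
  by (simp add: mtopology_of_submetric)

lemma almost_periodic_imp_bcontfun:
  fixes f :: "real \<Rightarrow> 'a::real_normed_vector"
  assumes "almost_periodic (submetric euclidean_metric S) f"
  shows "f \<in> bcontfun"
proof -
  have cont: "continuous_on UNIV f"
    using assms unfolding almost_periodic_def mtopology_of_submetric_euclidean
    by (auto simp: continuous_map_in_subtopology)
  have "relatively_dense (almost_periods (submetric euclidean_metric S) f 1)"
    using assms unfolding almost_periodic_def by simp
  then obtain l where "l > 0" and l: "\<And>c. {c..c + l} \<inter> {\<tau>. \<forall>t. dist (f (t + \<tau>)) (f t) < 1} \<noteq> {}"
    unfolding relatively_dense_def almost_periods_def by auto
  have "bounded (f ` {0..l})"
    by (intro compact_imp_bounded compact_continuous_image continuous_on_subset[OF cont]) auto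
  then obtain B where B: "\<And>t. t \<in> {0..l} \<Longrightarrow> norm (f t) \<le> B"
    unfolding bounded_iff by blast
  have "norm (f t) \<le> B + 1" for t
  proof -
    obtain \<tau> where \<tau>: "\<tau> \<in> {-t..-t + l}" "dist (f (t + \<tau>)) (f t) < 1"
      using l[of "-t"] by blast
    then have "norm (f (t + \<tau>)) \<le> B" by (intro B) auto
    then show ?thesis
      using \<tau>(2) norm_triangle_sub[of "f t" "f (t + \<tau>)"] by (simp add: dist_norm norm_minus_commute)
  qed
  then show ?thesis
    using cont unfolding bcontfun_def by (auto simp: bounded_iff)
qed

lemma apply_bcontfun_AP:
  "apply_bcontfun ` AP S = {f. almost_periodic (submetric euclidean_metric S) f}"
proof -
  have "f \<in> apply_bcontfun ` AP S" if "almost_periodic (submetric euclidean_metric S) f" for f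
    using almost_periodic_imp_bcontfun[OF that] that unfolding AP_def
    by (metis (mono_tags, lifting) bcontfunE image_eqI mem_Collect_eq)
  then show ?thesis by (auto simp: AP_def)
qed


section \<open>Hille-Yosida operators\<close>

text \<open>
  An unbounded operator is a pair of a domain \<open>D\<close> and a function \<open>A\<close> whose values off \<open>D\<close> are
  irrelevant. Only real points of the resolvent set are needed.
\<close>

definition resolvent :: "'a::real_vector set \<Rightarrow> ('a \<Rightarrow> 'a) \<Rightarrow> real \<Rightarrow> 'a \<Rightarrow> 'a" where
  "resolvent D A \<mu> = inv_into D (\<lambda>x. \<mu> *\<^sub>R x - A x)"

definition resolvent_set :: "'a::real_normed_vector set \<Rightarrow> ('a \<Rightarrow> 'a) \<Rightarrow> real set" where
  "resolvent_set D A =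
     {\<mu>. bij_betw (\<lambda>x. \<mu> *\<^sub>R x - A x) D UNIV \<and> bounded_linear (resolvent D A \<mu>)}"

definition hille_yosida :: "'a::real_normed_vector set \<Rightarrow> ('a \<Rightarrow> 'a) \<Rightarrow> real \<Rightarrow> real \<Rightarrow> bool" where
  "hille_yosida D A \<omega> M \<longleftrightarrow>
     subspace D \<and> linear_op_on D A \<and> M \<ge> 1 \<and> {\<omega><..} \<subseteq> resolvent_set D A \<and>
     (\<forall>\<mu>>\<omega>. \<forall>n\<ge>1. onorm (resolvent D A \<mu> ^^ n) \<le> M / (\<mu> - \<omega>) ^ n)"


section \<open>Ordered Banach spaces\<close>

definition positive_cone :: "'a::real_normed_vector set \<Rightarrow> bool" where
  "positive_cone K \<longleftrightarrow> closed K \<and> convex_cone K \<and> (\<forall>x. x \<in> K \<and> - x \<in> K \<longrightarrow> x = 0)"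

definition normal_cone :: "'a::real_normed_vector set \<Rightarrow> bool" where
  "normal_cone K \<longleftrightarrow> (\<exists>c. \<forall>x y. x \<in> K \<and> y - x \<in> K \<longrightarrow> norm x \<le> c * norm y)"

definition generating_cone :: "'a::real_normed_vector set \<Rightarrow> 'a set \<Rightarrow> bool" where
  "generating_cone E K \<longleftrightarrow> E = {x - y | x y. x \<in> K \<and> y \<in> K}"


section \<open>Evolution families and semigroups\<close>

text \<open>\<open>U t s\<close> is only meaningful for \<open>t \<ge> s\<close>, and only on \<open>E\<close>.\<close>

definition exp_bounded_evolution_family ::
    "'a::real_normed_vector set \<Rightarrow> (real \<Rightarrow> real \<Rightarrow> 'a \<Rightarrow> 'a) \<Rightarrow> bool" where
  "exp_bounded_evolution_family E U \<longleftrightarrow>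
     (\<forall>t s. s \<le> t \<longrightarrow> bounded_linear_on E (U t s) \<and> U t s \<in> E \<rightarrow> E) \<and>
     (\<forall>s. \<forall>x\<in>E. U s s x = x) \<and>
     (\<forall>t r s. s \<le> r \<and> r \<le> t \<longrightarrow> (\<forall>x\<in>E. U t r (U r s x) = U t s x)) \<and>
     (\<forall>x\<in>E. continuous_on {(t, s). s \<le> t} (\<lambda>(t, s). U t s x)) \<and>
     (\<exists>M \<omega>. \<forall>t s. s \<le> t \<longrightarrow> onorm_on E (U t s) \<le> M * exp (\<omega> * (t - s)))"

definition mild_solution ::
    "'a::banach set \<Rightarrow> ('a \<Rightarrow> 'a) \<Rightarrow> (real \<Rightarrow> 'a \<Rightarrow> 'a) \<Rightarrow> (real \<Rightarrow> 'a \<Rightarrow> 'a) \<Rightarrow> real \<Rightarrow> 'a \<Rightarrow>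
     (real \<Rightarrow> 'a) \<Rightarrow> bool" where
  "mild_solution D A F V t0 u0 u \<longleftrightarrow>
     continuous_on {t0..} u \<and> u \<in> {t0..} \<rightarrow> closure D \<and>
     (\<forall>t\<ge>t0. integral {t0..t} u \<in> D \<and>
        u t = u0 + A (integral {t0..t} u) + integral {t0..t} (\<lambda>s. F s (u s) - V s (u s)))"

definition solution_family ::
    "'a::banach set \<Rightarrow> ('a \<Rightarrow> 'a) \<Rightarrow> (real \<Rightarrow> 'a \<Rightarrow> 'a) \<Rightarrow> (real \<Rightarrow> 'a \<Rightarrow> 'a) \<Rightarrow>
     (real \<Rightarrow> real \<Rightarrow> 'a \<Rightarrow> 'a) \<Rightarrow> bool" where
  "solution_family D A F V U \<longleftrightarrow>
     (\<forall>t0. \<forall>u0\<in>closure D.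
        mild_solution D A F V t0 u0 (\<lambda>t. U t t0 u0) \<and>
        (\<forall>u. mild_solution D A F V t0 u0 u \<longrightarrow> (\<forall>t\<ge>t0. u t = U t t0 u0)))"

text \<open>A \<open>C\<^sub>0\<close>-semigroup on a Banach space \<open>E\<close>, given as a complete subspace of a normed space;
  \<open>T t\<close> is only meaningful for \<open>t \<ge> 0\<close>, and only on \<open>E\<close>.\<close>

definition C0_semigroup_on :: "'b::real_normed_vector set \<Rightarrow> (real \<Rightarrow> 'b \<Rightarrow> 'b) \<Rightarrow> bool" where
  "C0_semigroup_on E T \<longleftrightarrow>
     subspace E \<and> complete E \<and>
     (\<forall>t\<ge>0. bounded_linear_on E (T t) \<and> T t \<in> E \<rightarrow> E) \<and>
     (\<forall>x\<in>E. T 0 x = x) \<and>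
     (\<forall>t\<ge>0. \<forall>s\<ge>0. \<forall>x\<in>E. T (t + s) x = T t (T s x)) \<and>
     (\<forall>x\<in>E. ((\<lambda>t. T t x) \<longlongrightarrow> x) (at_right 0))"

definition evolution_fun ::
    "(real \<Rightarrow> real \<Rightarrow> 'a \<Rightarrow> 'a) \<Rightarrow> real \<Rightarrow> (real \<Rightarrow>\<^sub>C 'a::real_normed_vector) \<Rightarrow> real \<Rightarrow> 'a" where
  "evolution_fun U t \<phi> = (\<lambda>s. U s (s - t) (apply_bcontfun \<phi> (s - t)))"

text \<open>\<^const>\<open>Bcontfun\<close> is unspecified off \<^const>\<open>bcontfun\<close>, so statements about
  \<open>evolution_semigroup\<close> need \<open>evolution_fun U t \<phi> \<in> bcontfun\<close> to have their intended meaning.\<close>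

definition evolution_semigroup ::
    "(real \<Rightarrow> real \<Rightarrow> 'a \<Rightarrow> 'a) \<Rightarrow> real \<Rightarrow> (real \<Rightarrow>\<^sub>C 'a::real_normed_vector) \<Rightarrow> (real \<Rightarrow>\<^sub>C 'a)" where
  "evolution_semigroup U t \<phi> = Bcontfun (evolution_fun U t \<phi>)"

end

theory Submission
  imports Defs
begin

text \<open>
  If \<open>\<tau>\<close> is an \<open>e\<close>-almost period of \<open>F\<close> and \<open>V\<close>, then \<open>U (s + \<tau> + t) (s + \<tau>) x\<close> and \<open>U (s + t) s x\<close>
  are integrated solutions of equations whose coefficients differ by at most \<open>2 e\<close> in operator norm.
  The Hille-Yosida a priori estimate for integrated solutions, obtained from the implicit Euler scheme,
  bounds their distance by a multiple of \<open>e\<close>, uniformly in \<open>s\<close> and in small \<open>t\<close>. Almost periods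
  common to \<open>F\<close>, \<open>V\<close> and \<open>\<phi>\<close>, which are relatively dense, are therefore almost periods of
  \<open>s \<mapsto> U (s + t) s (\<phi> s)\<close>. For small \<open>t\<close> this gives invariance of the almost periodic functions,
  and the evolution property extends it to all \<open>t\<close>; strong continuity at \<open>0\<close> follows because the
  supremum over \<open>s\<close> is attained up to \<open>e\<close> on a compact interval.
\<close>

section \<open>Almost periods\<close>

text \<open>These properties of the sets of \<open>e\<close>-almost periods are stated without a
  function, so that functions into different metric spaces can be combined. The second clause is the
  triangle inequality, the third encodes uniform continuity. Monotonicity in \<open>e\<close>
  follows from them by subtracting the almost period 0.\<close>

definition bohr_family :: "(real \<Rightarrow> real set) \<Rightarrow> bool" where
  "bohr_family P \<longleftrightarrow>
     (\<forall>e>0. relatively_dense (P e)) \<and>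
     (\<forall>d e p q. p \<in> P d \<longrightarrow> q \<in> P e \<longrightarrow> p - q \<in> P (d + e)) \<and>
     (\<forall>e>0. \<exists>\<delta>>0. \<forall>p. \<bar>p\<bar> < \<delta> \<longrightarrow> p \<in> P e)"

lemma bohr_familyD:
  assumes "bohr_family P"
  shows "e > 0 \<Longrightarrow> relatively_dense (P e)"
    and "p \<in> P d \<Longrightarrow> q \<in> P e \<Longrightarrow> p - q \<in> P (d + e)"
    and "e > 0 \<Longrightarrow> \<exists>\<delta>>0. \<forall>p. \<bar>p\<bar> < \<delta> \<longrightarrow> p \<in> P e"
  using assms unfolding bohr_family_def by blast+

lemma relatively_dense_mono:
  assumes "relatively_dense S" "S \<subseteq> T"
  shows "relatively_dense T"
  using assms unfolding relatively_dense_def by blast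

text \<open>Pigeonhole: the differences \<open>p - q\<close> of nearby \<open>p \<in> P\<close> and \<open>q \<in> Q\<close> fall into finitely many cells of
  length \<open>\<delta>\<close>, and one fixed pair per cell can be subtracted from all others.\<close>

lemma relatively_dense_differences:
  assumes P: "relatively_dense P" and Q: "relatively_dense Q" and "\<delta> > 0"
  shows "relatively_dense
           {\<tau>. \<exists>p\<in>P. \<exists>p'\<in>P. \<exists>q\<in>Q. \<exists>q'\<in>Q. \<tau> = p - p' \<and> \<bar>\<tau> - (q - q')\<bar> < \<delta>}"
    (is "relatively_dense ?R")
proof -
  obtain lP where lP: "lP > 0" "\<And>c. {c..c + lP} \<inter> P \<noteq> {}"
    using P unfolding relatively_dense_def by blast
  obtain lQ where lQ: "lQ > 0" "\<And>c. {c..c + lQ} \<inter> Q \<noteq> {}"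
    using Q unfolding relatively_dense_def by blast
  define l where "l = max lP lQ"
  have near: "\<exists>p\<in>P. \<exists>q\<in>Q. p \<in> {c..c + l} \<and> q \<in> {c..c + l}" for c
    using lP(2)[of c] lQ(2)[of c] unfolding l_def by fastforce
  define cell where "cell p q = \<lfloor>(p - q) / \<delta>\<rfloor>" for p q :: real
  define Z where "Z = {z. \<exists>c. \<exists>p\<in>P. \<exists>q\<in>Q. p \<in> {c..c + l} \<and> q \<in> {c..c + l} \<and> cell p q = z}"
  \<comment> \<open>Points of a common window of length \<open>l\<close> differ by at most
    \<open>l\<close>, so only finitely many cells occur.\<close>
  have "Z \<subseteq> {\<lfloor>- l / \<delta>\<rfloor>..\<lfloor>l / \<delta>\<rfloor>}"
  proof
    fix z assume "z \<in> Z"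
    then obtain p q where "z = cell p q" "- l \<le> p - q" "p - q \<le> l"
      unfolding Z_def by fastforce
    moreover from this have "- l / \<delta> \<le> (p - q) / \<delta>" "(p - q) / \<delta> \<le> l / \<delta>"
      using \<open>\<delta> > 0\<close> by (intro divide_right_mono; simp)+
    ultimately show "z \<in> {\<lfloor>- l / \<delta>\<rfloor>..\<lfloor>l / \<delta>\<rfloor>}"
      unfolding cell_def by (simp only: atLeastAtMost_iff floor_mono simp_thms)
  qed
  then have "finite Z" by (rule finite_subset) simp
  have "\<forall>z\<in>Z. \<exists>pq. fst pq \<in> P \<and> snd pq \<in> Q \<and> cell (fst pq) (snd pq) = z"
    unfolding Z_def by force
  then obtain rep where rep: "\<And>z. z \<in> Z \<Longrightarrow> fst (rep z) \<in> P \<and> snd (rep z) \<in> Q \<and> cell (fst (rep z)) (snd (rep z)) = z"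
    by metis
  obtain L where L: "\<And>z. z \<in> Z \<Longrightarrow> \<bar>fst (rep z)\<bar> \<le> L"
    using finite_imp_bounded[OF finite_imageI[OF \<open>finite Z\<close>, of "\<lambda>z. fst (rep z)"]]
    unfolding bounded_iff by auto
  \<comment> \<open>The pair is sought in a window shifted by \<open>\<bar>L\<bar>\<close>, so that
    subtracting a representative of size at most \<open>\<bar>L\<bar>\<close> cannot leave the
    interval.\<close>
  have "{c..c + (l + 2 * \<bar>L\<bar> )} \<inter> ?R \<noteq> {}" for c
  proof -
    obtain p q where pq: "p \<in> P" "q \<in> Q" "p \<in> {c + \<bar>L\<bar>..c + \<bar>L\<bar> + l}" "q \<in> {c + \<bar>L\<bar>..c + \<bar>L\<bar> + l}"
      using near by blast
    define z where "z = cell p q"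
    have "z \<in> Z" using pq unfolding Z_def z_def by blast
    note r = rep[OF this] L[OF this]
    have "\<bar>(p - q) / \<delta> - (fst (rep z) - snd (rep z)) / \<delta>\<bar> < 1"
      using r(1) unfolding z_def cell_def by linarith
    then have "\<bar>(p - fst (rep z)) - (q - snd (rep z))\<bar> < \<delta>"
      using \<open>\<delta> > 0\<close> by (simp add: divide_simps abs_if split: if_splits)
    then have "p - fst (rep z) \<in> ?R" using pq r by blast
    moreover have "p - fst (rep z) \<in> {c..c + (l + 2 * \<bar>L\<bar>)}" using pq(3) r(2) by auto
    ultimately show ?thesis by blast
  qed
  moreover have "l + 2 * \<bar>L\<bar> > 0" using lP(1) unfolding l_def by linarith
  ultimately show ?thesis unfolding relatively_dense_def by blast
qed

text \<open>A difference of two elements of \<open>P\<close> that lies within \<delta> of a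
  difference of two elements of \<open>Q\<close> is good for both families, because the correction
  shorter than \<delta> itself belongs to \<open>Q\<close>. Such differences are relatively dense by
  the pigeonhole argument.\<close>

lemma bohr_family_Int:
  assumes P: "bohr_family P" and Q: "bohr_family Q"
  shows "bohr_family (\<lambda>e. P e \<inter> Q e)"
proof -
  have mono: "x \<in> R e" if "bohr_family R" "x \<in> R d" "d < e" for R x d e
  proof -
    have "0 \<in> R (e - d)" using bohr_familyD(3)[OF that(1), of "e - d"] that(3) by force
    then have "x - 0 \<in> R (d + (e - d))" using bohr_familyD(2)[OF that(1,2)] by blast
    then show ?thesis by simp
  qed
  have "relatively_dense (P e \<inter> Q e)" if "e > 0" for e
  proof -
    \<comment> \<open>On the \<open>P\<close> side the difference costs \<open>e/4 + e/4\<close>; on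
      the \<open>Q\<close> side the correction adds a third \<open>e/4\<close>. Both totals stay
      strictly below \<open>e\<close>, as \<open>mono\<close> requires.\<close>
    obtain \<delta> where \<delta>: "\<delta> > 0" "\<And>p. \<bar>p\<bar> < \<delta> \<Longrightarrow> p \<in> Q (e/4)"
      using bohr_familyD(3)[OF Q, of "e/4"] \<open>e > 0\<close> by auto
    have rd: "relatively_dense (P (e/4))" "relatively_dense (Q (e/4))"
      using P Q \<open>e > 0\<close> unfolding bohr_family_def by simp_all
    show ?thesis
    proof (rule relatively_dense_mono[OF relatively_dense_differences[OF rd \<delta>(1)]], safe)
      fix p p' q q' assume *: "p \<in> P (e/4)" "p' \<in> P (e/4)" "q \<in> Q (e/4)" "q' \<in> Q (e/4)"
        and d: "\<bar>p - p' - (q - q')\<bar> < \<delta>"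
      have "p - p' \<in> P (e/4 + e/4)" using P * unfolding bohr_family_def by blast
      then show "p - p' \<in> P e" using mono[OF P] \<open>e > 0\<close> by simp
      have 1: "q - q' \<in> Q (e/4 + e/4)" using Q * unfolding bohr_family_def by blast
      have 2: "(q - q') - (p - p') \<in> Q (e/4)" by (intro \<delta>(2)) (use d in linarith)
      have "(q - q') - ((q - q') - (p - p')) \<in> Q (e/4 + e/4 + e/4)"
        using Q 1 2 unfolding bohr_family_def by blast
      then show "p - p' \<in> Q e" using mono[OF Q] \<open>e > 0\<close> by simp
    qed
  qed
  moreover have "\<exists>\<delta>>0. \<forall>p. \<bar>p\<bar> < \<delta> \<longrightarrow> p \<in> P e \<inter> Q e" if "e > 0" for e
  proof -
    obtain \<delta>1 \<delta>2 where "\<delta>1 > 0" "\<And>p. \<bar>p\<bar> < \<delta>1 \<Longrightarrow> p \<in> P e" "\<delta>2 > 0" "\<And>p. \<bar>p\<bar> < \<delta>2 \<Longrightarrow> p \<in> Q e"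
      using bohr_familyD(3)[OF P \<open>e > 0\<close>] bohr_familyD(3)[OF Q \<open>e > 0\<close>] by blast
    then show ?thesis by (intro exI[of _ "min \<delta>1 \<delta>2"]) auto
  qed
  moreover have "p - q \<in> P (d + e) \<inter> Q (d + e)" if "p \<in> P d \<inter> Q d" "q \<in> P e \<inter> Q e" for d e p q
    using that bohr_familyD(2)[OF P, of p d q e] bohr_familyD(2)[OF Q, of p d q e] by blast
  ultimately show ?thesis unfolding bohr_family_def by (intro conjI allI impI)
qed

section \<open>Continuity, boundedness and almost periods in an abstract metric\<close>

lemma continuous_map_realD:
  fixes f :: "real \<Rightarrow> 'b"
  assumes "continuous_map euclidean (mtopology_of m) f"
  shows "f t \<in> mspace m"
    and "e > 0 \<Longrightarrow> \<exists>\<delta>>0. \<forall>s. dist s t < \<delta> \<longrightarrow> mdist m (f s) (f t) < e"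
proof -
  show mem: "f t \<in> mspace m" for t
    using continuous_map_image_subset_topspace[OF assms] by auto
  interpret Metric_space "mspace m" "mdist m" by simp
  show "\<exists>\<delta>>0. \<forall>s. dist s t < \<delta> \<longrightarrow> mdist m (f s) (f t) < e" if "e > 0"
  proof -
    have "\<exists>U. open U \<and> t \<in> U \<and> (\<forall>s\<in>U. f s \<in> mball (f t) e)"
      using assms that unfolding mtopology_of_def continuous_map_to_metric by simp
    then obtain U where "open U" "t \<in> U" "\<And>s. s \<in> U \<Longrightarrow> mdist m (f t) (f s) < e" by auto
    then show ?thesis unfolding open_dist by (metis mdist_commute)
  qed
qed

text \<open>Replaces a function into an abstract metric by a real function of two real variables, to
  which compactness arguments on the line apply.\<close>

lemma continuous_on_mdist:
  fixes f :: "real \<Rightarrow> 'b"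
  assumes f: "continuous_map euclidean (mtopology_of m) f"
  shows "continuous_on S (\<lambda>(s, t). mdist m (f s) (f t))"
  unfolding continuous_on_iff
proof (intro ballI allI impI)
  fix z :: "real \<times> real" and e :: real assume "e > 0"
  obtain s t where z: "z = (s, t)" by fastforce
  obtain d1 where d1: "d1 > 0" "\<And>s'. dist s' s < d1 \<Longrightarrow> mdist m (f s') (f s) < e/2"
    using continuous_map_realD(2)[OF f, of "e/2" s] \<open>e > 0\<close> by auto
  obtain d2 where d2: "d2 > 0" "\<And>s'. dist s' t < d2 \<Longrightarrow> mdist m (f s') (f t) < e/2"
    using continuous_map_realD(2)[OF f, of "e/2" t] \<open>e > 0\<close> by auto
  have "dist (mdist m (f s') (f t')) (mdist m (f s) (f t)) < e"
    if "dist (s', t') z < min d1 d2" for s' t'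
  proof -
    have *: "mdist m (f s') (f s) < e/2" "mdist m (f t') (f t) < e/2"
      using that d1 d2 dist_fst_le[of "(s', t')" z] dist_snd_le[of "(s', t')" z] unfolding z by auto
    have tri: "mdist m (f a) (f b) \<le> mdist m (f a) (f c) + mdist m (f c) (f b)" for a b c
      by (intro mdist_triangle continuous_map_realD(1)[OF f])
    show ?thesis using * tri[of s' t' s] tri[of s t' t] tri[of s t s'] tri[of s' t t']
      mdist_commute[of m "f s" "f s'"] mdist_commute[of m "f t" "f t'"] unfolding dist_real_def abs_less_iff by (intro conjI; linarith)
  qed
  then show "\<exists>d>0. \<forall>z'\<in>S. dist z' z < d \<longrightarrow>
      dist (case z' of (s, t) \<Rightarrow> mdist m (f s) (f t)) (case z of (s, t) \<Rightarrow> mdist m (f s) (f t)) < e"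
    using d1(1) d2(1) z by (intro exI[of _ "min d1 d2"]) auto
qed

text \<open>An almost period carries any two nearby points into one fixed compact interval, where
  continuity is uniform; each of the two translations costs \<open>e/3\<close>.\<close>

lemma almost_periodic_uniformly_continuous:
  fixes f :: "real \<Rightarrow> 'b"
  assumes f: "almost_periodic m f" and "e > 0"
  shows "\<exists>\<delta>>0. \<forall>s t. \<bar>s - t\<bar> < \<delta> \<longrightarrow> mdist m (f s) (f t) < e"
proof -
  have c: "continuous_map euclidean (mtopology_of m) f"
    and "relatively_dense (almost_periods m f (e/3))"
    using assms unfolding almost_periodic_def by auto
  then obtain l where l: "l > 0" "\<And>c. {c..c + l} \<inter> almost_periods m f (e/3) \<noteq> {}"
    unfolding relatively_dense_def by blast
  define g where "g = (\<lambda>(s, t). mdist m (f s) (f t))"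
  \<comment> \<open>The translate of \<open>s\<close> lands in \<open>{0..l}\<close>. The margin 1
    on both sides leaves room for the translate of \<open>t\<close>, which is at distance less than
    1.\<close>
  have "uniformly_continuous_on ({-1..l+1} \<times> {-1..l+1}) g"
    unfolding g_def by (intro compact_uniformly_continuous continuous_on_mdist c compact_Times) auto
  then obtain d where d: "d > 0"
    "\<And>x y. x \<in> {-1..l+1} \<times> {-1..l+1} \<Longrightarrow> y \<in> {-1..l+1} \<times> {-1..l+1} \<Longrightarrow> dist x y < d \<Longrightarrow> dist (g x) (g y) < e/3"
    by (rule uniformly_continuous_onE[of _ _ "e/3"]) (use \<open>e > 0\<close> in \<open>auto simp: dist_commute\<close>)
  have "mdist m (f s) (f t) < e" if "\<bar>s - t\<bar> < min d 1" for s t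
  proof -
    obtain \<tau> where \<tau>: "\<tau> \<in> {-s..-s + l}" "\<And>t. mdist m (f (t + \<tau>)) (f t) < e/3"
      using l(2)[of "-s"] unfolding almost_periods_def by blast
    \<comment> \<open>The comparison point lies on the diagonal, where \<open>g\<close>
      vanishes.\<close>
    have "dist (g (s + \<tau>, t + \<tau>)) (g (s + \<tau>, s + \<tau>)) < e/3"
      using that \<tau>(1) by (intro d(2)) (auto simp: dist_Pair_Pair dist_real_def abs_minus_commute)
    then have *: "mdist m (f (s + \<tau>)) (f (t + \<tau>)) < e/3"
      using mdist_zero[OF continuous_map_realD(1)[OF c] continuous_map_realD(1)[OF c], of "s + \<tau>" "s + \<tau>"]
      by (simp add: g_def dist_real_def)
    have tri: "mdist m (f a) (f b) \<le> mdist m (f a) (f c) + mdist m (f c) (f b)" for a b c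
      by (intro mdist_triangle continuous_map_realD(1)[OF c])
    show ?thesis
      using * \<tau>(2)[of s] \<tau>(2)[of t] tri[of s t "s + \<tau>"] tri[of "s + \<tau>" t "t + \<tau>"]
        mdist_commute[of m "f s" "f (s + \<tau>)"] by linarith
  qed
  then show ?thesis using d(1) by (intro exI[of _ "min d 1"]) auto
qed

text \<open>An almost period moves \<open>t\<close> into \<open>{0..l}\<close> at a cost of at most
  1. The value at 0 serves as the reference point, there being no norm in an abstract
  metric.\<close>

lemma almost_periodic_bounded:
  fixes f :: "real \<Rightarrow> 'b"
  assumes f: "almost_periodic m f"
  shows "\<exists>B. \<forall>t. mdist m (f t) (f 0) \<le> B"
proof -
  have c: "continuous_map euclidean (mtopology_of m) f"
    and "relatively_dense (almost_periods m f 1)"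
    using assms unfolding almost_periodic_def by auto
  then obtain l where l: "l > 0" "\<And>c. {c..c + l} \<inter> almost_periods m f 1 \<noteq> {}"
    unfolding relatively_dense_def by blast
  have "bounded ((\<lambda>(s, t). mdist m (f s) (f t)) ` ({0..l} \<times> {0}))"
    by (intro compact_imp_bounded compact_continuous_image continuous_on_mdist c compact_Times) auto
  then obtain B where B: "\<And>t. t \<in> {0..l} \<Longrightarrow> mdist m (f t) (f 0) \<le> B"
    unfolding bounded_iff by fastforce
  have "mdist m (f t) (f 0) \<le> B + 1" for t
  proof -
    obtain \<tau> where \<tau>: "\<tau> \<in> {-t..-t + l}" "\<And>t. mdist m (f (t + \<tau>)) (f t) < 1"
      using l(2)[of "-t"] unfolding almost_periods_def by blast
    have "mdist m (f t) (f 0) \<le> mdist m (f t) (f (t + \<tau>)) + mdist m (f (t + \<tau>)) (f 0)"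
      by (intro mdist_triangle continuous_map_realD(1)[OF c])
    then show ?thesis using \<tau>(2)[of t] B[of "t + \<tau>"] \<tau>(1) by (simp add: mdist_commute)
  qed
  then show ?thesis by blast
qed

text \<open>Uniform continuity makes all short shifts almost periods; for differences, the values at
  \<open>t + (p - q)\<close> and at \<open>t\<close> are both compared with the value at
  \<open>t - q\<close>.\<close>

lemma bohr_family_almost_periods:
  fixes f :: "real \<Rightarrow> 'b"
  assumes f: "almost_periodic m f"
  shows "bohr_family (almost_periods m f)"
  unfolding bohr_family_def
proof (intro conjI allI impI)
  have c: "continuous_map euclidean (mtopology_of m) f"
    using f unfolding almost_periodic_def by auto
  show "relatively_dense (almost_periods m f e)" if "e > 0" for e
    using f that unfolding almost_periodic_def by blast
  show "\<exists>\<delta>>0. \<forall>p. \<bar>p\<bar> < \<delta> \<longrightarrow> p \<in> almost_periods m f e" if "e > 0" for e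
  proof -
    obtain \<delta> where "\<delta> > 0" "\<And>s t. \<bar>s - t\<bar> < \<delta> \<Longrightarrow> mdist m (f s) (f t) < e"
      using almost_periodic_uniformly_continuous[OF f \<open>e > 0\<close>] by blast
    then show ?thesis unfolding almost_periods_def by auto
  qed
  show "p - q \<in> almost_periods m f (d + e)"
    if "p \<in> almost_periods m f d" "q \<in> almost_periods m f e" for d e p q
  proof -
    have "mdist m (f (t + (p - q))) (f t) < d + e" for t
    proof -
      have "mdist m (f (t - q + p)) (f (t - q)) < d" "mdist m (f (t - q + q)) (f (t - q)) < e"
        using that unfolding almost_periods_def by blast+
      moreover have "mdist m (f (t - q + p)) (f t) \<le> mdist m (f (t - q + p)) (f (t - q)) + mdist m (f (t - q)) (f t)"
        by (intro mdist_triangle continuous_map_realD(1)[OF c])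
      ultimately show ?thesis by (simp add: mdist_commute algebra_simps)
    qed
    then show ?thesis unfolding almost_periods_def by blast
  qed
qed

lemma almost_periodic_on_iff:
  fixes f :: "real \<Rightarrow> 'a::real_normed_vector"
  shows "almost_periodic (submetric euclidean_metric S) f \<longleftrightarrow>
     continuous_on UNIV f \<and> range f \<subseteq> S \<and> (\<forall>e>0. relatively_dense {\<tau>. \<forall>t. norm (f (t + \<tau>) - f t) < e})"
  unfolding almost_periodic_def mtopology_of_submetric_euclidean almost_periods_def
  by (auto simp: continuous_map_in_subtopology dist_norm)

section \<open>The space of almost periodic functions\<close>

lemma apply_bcontfun_in_AP_carrier: "\<phi> \<in> AP S \<Longrightarrow> apply_bcontfun \<phi> t \<in> S"
  unfolding AP_def almost_periodic_on_iff by blast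

text \<open>Sums are the substantial case: they need almost periods common to both summands, which
  \<open>bohr_family_Int\<close> provides.\<close>

lemma subspace_AP:
  assumes "subspace S"
  shows "subspace (AP S)"
  unfolding subspace_def
proof (intro conjI allI ballI)
  have "relatively_dense UNIV" unfolding relatively_dense_def by (auto intro: exI[of _ 1])
  then show "0 \<in> AP S"
    using subspace_0[OF assms] unfolding AP_def almost_periodic_on_iff by auto
next
  fix \<phi> \<psi> assume *: "\<phi> \<in> AP S" "\<psi> \<in> AP S"
  let ?P = "\<lambda>\<phi>. almost_periods (submetric euclidean_metric S) (apply_bcontfun \<phi>)"
  have "bohr_family (\<lambda>e. ?P \<phi> e \<inter> ?P \<psi> e)"
    using * unfolding AP_def by (intro bohr_family_Int bohr_family_almost_periods) auto
  then have rd: "relatively_dense (?P \<phi> (e/2) \<inter> ?P \<psi> (e/2))" if "e > 0" for e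
    using that unfolding bohr_family_def by simp
  have "relatively_dense {\<tau>. \<forall>t. norm ((\<phi> + \<psi>) (t + \<tau>) - (\<phi> + \<psi>) t) < e}" if "e > 0" for e
  proof (rule relatively_dense_mono[OF rd[OF that]], safe)
    fix \<tau> t assume "\<tau> \<in> ?P \<phi> (e/2)" "\<tau> \<in> ?P \<psi> (e/2)"
    then have "norm (\<phi> (t + \<tau>) - \<phi> t) < e/2" "norm (\<psi> (t + \<tau>) - \<psi> t) < e/2"
      unfolding almost_periods_def by (simp_all add: dist_norm)
    then show "norm ((\<phi> + \<psi>) (t + \<tau>) - (\<phi> + \<psi>) t) < e"
      using norm_triangle_ineq[of "\<phi> (t + \<tau>) - \<phi> t" "\<psi> (t + \<tau>) - \<psi> t"] by (simp add: algebra_simps)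
  qed
  then show "\<phi> + \<psi> \<in> AP S"
    using * subspace_add[OF assms] unfolding AP_def almost_periodic_on_iff image_subset_iff
    by simp
next
  fix c \<phi> assume *: "\<phi> \<in> AP S"
  have "relatively_dense {\<tau>. \<forall>t. norm ((c *\<^sub>R \<phi>) (t + \<tau>) - (c *\<^sub>R \<phi>) t) < e}" if "e > 0" for e
  proof (rule relatively_dense_mono)
    \<comment> \<open>The added 1 in the denominator covers the scalar 0.\<close>
    show "relatively_dense {\<tau>. \<forall>t. norm (\<phi> (t + \<tau>) - \<phi> t) < e / (\<bar>c\<bar> + 1)}"
      using * that unfolding AP_def almost_periodic_on_iff by simp
    show "{\<tau>. \<forall>t. norm (\<phi> (t + \<tau>) - \<phi> t) < e / (\<bar>c\<bar> + 1)} \<subseteq> {\<tau>. \<forall>t. norm ((c *\<^sub>R \<phi>) (t + \<tau>) - (c *\<^sub>R \<phi>) t) < e}"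
    proof safe
      fix \<tau> t assume "\<forall>t. norm (\<phi> (t + \<tau>) - \<phi> t) < e / (\<bar>c\<bar> + 1)"
      then have "norm (\<phi> (t + \<tau>) - \<phi> t) < e / (\<bar>c\<bar> + 1)" by blast
      then have "(\<bar>c\<bar> + 1) * norm (\<phi> (t + \<tau>) - \<phi> t) < e"
        by (simp add: pos_less_divide_eq mult.commute)
      moreover have "norm ((c *\<^sub>R \<phi>) (t + \<tau>) - (c *\<^sub>R \<phi>) t) = \<bar>c\<bar> * norm (\<phi> (t + \<tau>) - \<phi> t)"
        by (simp flip: scaleR_diff_right)
      moreover have "\<bar>c\<bar> * norm (\<phi> (t + \<tau>) - \<phi> t) \<le> (\<bar>c\<bar> + 1) * norm (\<phi> (t + \<tau>) - \<phi> t)"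
        by (intro mult_right_mono) auto
      ultimately show "norm ((c *\<^sub>R \<phi>) (t + \<tau>) - (c *\<^sub>R \<phi>) t) < e" by linarith
    qed
  qed
  then show "c *\<^sub>R \<phi> \<in> AP S"
    using * subspace_scale[OF assms] unfolding AP_def almost_periodic_on_iff image_subset_iff
    by simp
qed

text \<open>An \<open>e/3\<close>-almost period of a member within \<open>e/3\<close> of the uniform
  limit is an \<open>e\<close>-almost period of the limit.\<close>

lemma closed_AP:
  fixes S :: "'a::real_normed_vector set"
  assumes "closed S"
  shows "closed (AP S)"
  unfolding closed_sequential_limits
proof safe
  fix f and \<phi> :: "real \<Rightarrow>\<^sub>C 'a"
  assume f: "\<forall>n. f n \<in> AP S" and lim: "f \<longlonglongrightarrow> \<phi>"
  have "\<phi> t \<in> S" for t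
  proof (rule closed_sequentially[OF assms])
    show "\<And>n. f n t \<in> S" using f apply_bcontfun_in_AP_carrier by blast
    show "(\<lambda>n. f n t) \<longlonglongrightarrow> \<phi> t"
      by (rule tendsto_uniform_limitI[OF tendsto_bcontfun_uniform_limit[OF lim]]) simp
  qed
  moreover have "relatively_dense {\<tau>. \<forall>t. norm (\<phi> (t + \<tau>) - \<phi> t) < e}" if "e > 0" for e
  proof -
    obtain n where n: "dist (f n) \<phi> < e/3"
      using lim \<open>e > 0\<close> unfolding lim_sequentially by (metis divide_pos_pos order_refl zero_less_numeral)
    show ?thesis
    proof (rule relatively_dense_mono)
      show "relatively_dense {\<tau>. \<forall>t. norm (f n (t + \<tau>) - f n t) < e/3}"
      proof -
        have "e/3 > 0" using \<open>e > 0\<close> by simp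
        moreover have "f n \<in> AP S" using f by simp
        ultimately show ?thesis unfolding AP_def almost_periodic_on_iff by blast
      qed
      show "{\<tau>. \<forall>t. norm (f n (t + \<tau>) - f n t) < e/3} \<subseteq> {\<tau>. \<forall>t. norm (\<phi> (t + \<tau>) - \<phi> t) < e}"
      proof safe
        fix \<tau> t assume "\<forall>t. norm (f n (t + \<tau>) - f n t) < e/3"
        then have "dist (f n (t + \<tau>)) (f n t) < e/3" by (simp add: dist_norm)
        moreover have "dist (f n (t + \<tau>)) (\<phi> (t + \<tau>)) < e/3" "dist (f n t) (\<phi> t) < e/3"
          using n dist_fun_lt_imp_dist_val_lt by blast+
        ultimately have "dist (\<phi> (t + \<tau>)) (\<phi> t) < e"
          using dist_triangle[of "\<phi> (t + \<tau>)" "\<phi> t" "f n (t + \<tau>)"]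
            dist_triangle[of "f n (t + \<tau>)" "\<phi> t" "f n t"]
            dist_commute[of "\<phi> (t + \<tau>)" "f n (t + \<tau>)"] by linarith
        then show "norm (\<phi> (t + \<tau>) - \<phi> t) < e" by (simp add: dist_norm)
      qed
    qed
  qed
  ultimately show "\<phi> \<in> AP S" unfolding AP_def almost_periodic_on_iff by auto
qed

section \<open>Integrated solutions for Hille-Yosida operators\<close>

lemma linear_op_on_diff_arg:
  assumes "linear_op_on S T" "subspace S" "x \<in> S" "y \<in> S"
  shows "T (x - y) = T x - T y"
proof -
  have "T (x + (-1) *\<^sub>R y) = T x + (-1) *\<^sub>R T y"
    using assms subspace_scale[OF assms(2,4), of "-1"] unfolding linear_op_on_def by metis
  then show ?thesis by simp
qed

text \<open>Discrete variation of constants. One constant \<open>P\<close> bounds all powers of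
  \<open>R\<close> at once; multiplying one-step bounds would raise the Hille-Yosida constant
  \<open>M\<close> to the power \<open>n\<close>.\<close>

lemma norm_perturbed_iteration_le:
  fixes R :: "'a::real_normed_vector \<Rightarrow> 'a" and n :: nat
  assumes R: "linear R"
    and step: "\<And>i. i < n \<Longrightarrow> v (Suc i) = R (v i + e i)"
    and e: "\<And>i. i < n \<Longrightarrow> norm (e i) \<le> q"
    and P: "\<And>j x. j \<le> n \<Longrightarrow> norm ((R ^^ j) x) \<le> P * norm x" and "P \<ge> 0"
  shows "norm (v n) \<le> P * (norm (v 0) + real n * q)"
proof -
  have v: "v m = (R ^^ m) (v 0) + (\<Sum>i<m. (R ^^ (m - i)) (e i))" if "m \<le> n" for m
    using that
  proof (induction m)
    case (Suc m)
    have "(\<Sum>i<m. (R ^^ (Suc m - i)) (e i)) = R (\<Sum>i<m. (R ^^ (m - i)) (e i))"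
      unfolding linear_sum[OF R] by (intro sum.cong) (simp_all add: Suc_diff_le)
    then show ?case
      using Suc step[of m] by (simp add: linear_add[OF R])
  qed simp
  have "norm (v n) \<le> norm ((R ^^ n) (v 0)) + (\<Sum>i<n. norm ((R ^^ (n - i)) (e i)))"
    unfolding v[OF order_refl] by (intro norm_triangle_le add_left_mono norm_sum)
  also have "\<dots> \<le> P * norm (v 0) + (\<Sum>i<n. P * q)"
  proof (intro add_mono P sum_mono order_refl)
    fix i assume "i \<in> {..<n}"
    then have "norm ((R ^^ (n - i)) (e i)) \<le> P * norm (e i)" "norm (e i) \<le> q"
      using P[of "n - i" "e i"] e by auto
    then show "norm ((R ^^ (n - i)) (e i)) \<le> P * q"
      using mult_left_mono[OF _ \<open>P \<ge> 0\<close>] by fastforce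
  qed
  finally show ?thesis by (simp add: algebra_simps)
qed

text \<open>Here \<open>R\<close> is the implicit Euler step, the inverse of \<open>I - h A\<close>.
  The restriction on \<open>h\<close> puts \<open>1/h\<close> into the resolvent set and keeps the
  growth factor \<open>1 / (1 - h * \<omega>)\<close> below an exponential.\<close>

lemma
  assumes HY: "hille_yosida D A \<omega> M" and h: "h > 0" "h * max \<omega> 0 \<le> 1/2"
  defines "R \<equiv> \<lambda>x. resolvent D A (1/h) ((1/h) *\<^sub>R x)"
  shows euler_step_linear: "linear R"
    and euler_step_inverse: "\<And>x. x \<in> D \<Longrightarrow> R (x - h *\<^sub>R A x) = x"
    and norm_euler_step_power_le:
      "\<And>j x. norm ((R ^^ j) x) \<le> M * exp (2 * max \<omega> 0 * h * real j) * norm x"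
proof -
  define Q where "Q = resolvent D A (1/h)"
  have "h * \<omega> \<le> 1/2" using h by (smt (verit) mult_left_mono max.cobounded1)
  then have gt: "1/h > \<omega>" using h(1) by (simp add: field_simps)
  then have "1/h \<in> resolvent_set D A" using HY unfolding hille_yosida_def by blast
  then have bij: "bij_betw (\<lambda>x. (1/h) *\<^sub>R x - A x) D UNIV" and Q: "bounded_linear Q"
    unfolding resolvent_set_def Q_def by auto
  interpret Q: bounded_linear Q by (rule Q)
  have R: "R = (\<lambda>x. (1/h) *\<^sub>R Q x)" unfolding R_def Q_def[symmetric] by (simp add: Q.scaleR)
  show "linear R" unfolding R
    by (intro linearI) (simp_all add: Q.add Q.scaleR algebra_simps)
  show "R (x - h *\<^sub>R A x) = x" if "x \<in> D" for x
  proof -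
    have "R (x - h *\<^sub>R A x) = Q ((1/h) *\<^sub>R x - A x)"
      unfolding R_def Q_def[symmetric] using h(1) by (simp add: algebra_simps)
    also have "\<dots> = x"
      unfolding Q_def resolvent_def using bij that
      by (metis (no_types, lifting) bij_betw_imp_inj_on inv_into_f_f)
    finally show ?thesis .
  qed
  fix j :: nat and x
  have Rj: "(R ^^ j) x = (1/h) ^ j *\<^sub>R (Q ^^ j) x"
    by (induction j) (simp_all add: R Q.scaleR)
  have bl: "bounded_linear (Q ^^ j)"
    by (induction j) (auto intro: bounded_linear_compose[OF Q] bounded_linear_ident simp: id_def)
  have M: "M \<ge> 1" using HY unfolding hille_yosida_def by blast
  show "norm ((R ^^ j) x) \<le> M * exp (2 * max \<omega> 0 * h * real j) * norm x"
  proof (cases "j = 0")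
    \<comment> \<open>The Hille-Yosida estimate starts at the first power; the zeroth is covered by
      \<open>M \<ge> 1\<close>.\<close>
    case True
    then show ?thesis using M by (simp add: mult_le_cancel_right1)
  next
    case False
    then have "onorm (Q ^^ j) \<le> M / (1/h - \<omega>) ^ j"
      using HY gt unfolding hille_yosida_def Q_def by simp
    then have "norm ((Q ^^ j) x) \<le> M / (1/h - \<omega>) ^ j * norm x"
      using onorm[OF bl, of x] by (meson mult_right_mono norm_ge_zero order_trans)
    then have "norm ((R ^^ j) x) \<le> (1/h) ^ j * (M / (1/h - \<omega>) ^ j * norm x)"
      unfolding Rj norm_scaleR using h(1) by (simp only: abs_of_nonneg zero_le_power zero_le_divide_1_iff less_imp_le mult_left_mono)
    also have "\<dots> = M * (1 / (h * (1/h - \<omega>))) ^ j * norm x"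
      by (simp add: power_mult_distrib power_divide)
    also have "h * (1/h - \<omega>) = 1 - h * \<omega>" using h(1) by (simp add: algebra_simps)
    also have "M * (1 / (1 - h * \<omega>)) ^ j * norm x \<le> M * exp (2 * max \<omega> 0 * h) ^ j * norm x"
    proof (intro mult_right_mono mult_left_mono power_mono)
      \<comment> \<open>For y between 0 and 1/2 one has (1 + 2y)(1 - y) \<ge> 1, hence 1/(1 - y)
        \<le> 1 + 2y \<le> exp(2y).\<close>
      define y where "y = max \<omega> 0 * h"
      have y: "0 \<le> y" "y \<le> 1/2" "h * \<omega> \<le> y"
        using h unfolding y_def by (auto simp: mult.commute intro!: mult_left_mono)
      have "y * y \<le> 1/2 * y" using y by (intro mult_right_mono) auto
      then have "1 \<le> (1 + 2 * y) * (1 - y)" by (simp add: algebra_simps)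
      also have "\<dots> \<le> exp (2 * y) * (1 - h * \<omega>)"
        using y by (intro mult_mono exp_ge_add_one_self) auto
      finally show "1 / (1 - h * \<omega>) \<le> exp (2 * max \<omega> 0 * h)"
        using y unfolding y_def by (simp add: field_simps)
      show "0 \<le> 1 / (1 - h * \<omega>)" using y by simp
    qed (use M in auto)
    also have "exp (2 * max \<omega> 0 * h) ^ j = exp (2 * max \<omega> 0 * h * real j)"
      by (simp add: mult_ac flip: exp_of_nat_mult)
    finally show ?thesis .
  qed
qed

text \<open>On a fine grid a strict solution is an implicit Euler iteration whose perturbations are
  the inhomogeneity plus a consistency error. Uniform continuity of \<open>v'\<close> makes the
  latter small relative to the step. Since \<open>T \<le> 1\<close>, a single constant bounds all
  powers of the Euler step.\<close>

lemma strict_solution_bound: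
  fixes v v' k :: "real \<Rightarrow> 'a::real_normed_vector"
  assumes HY: "hille_yosida D A \<omega> M" and T: "0 < T" "T \<le> 1"
    and v: "\<And>t. t \<in> {0..T} \<Longrightarrow> v t \<in> D"
    and deriv: "\<And>t. t \<in> {0..T} \<Longrightarrow> (v has_vector_derivative v' t) (at t within {0..T})"
    and cont: "continuous_on {0..T} v'"
    and eq: "\<And>t. t \<in> {0..T} \<Longrightarrow> v' t = A (v t) + k t"
    and k: "\<And>t. t \<in> {0..T} \<Longrightarrow> norm (k t) \<le> c"
  shows "norm (v T) \<le> M * exp (2 * max \<omega> 0) * (norm (v 0) + T * c)"
proof (rule field_le_epsilon)
  fix \<epsilon> :: real assume "\<epsilon> > 0"
  define C where "C = M * exp (2 * max \<omega> 0)"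
  have "M \<ge> 1" using HY unfolding hille_yosida_def by blast
  then have "C > 0" unfolding C_def by simp
  \<comment> \<open>The consistency errors add up to at most \<open>C * T * \<eta>\<close>, which
    \<open>T \<le> 1\<close> keeps below \<epsilon>.\<close>
  define \<eta> where "\<eta> = \<epsilon> / C"
  have \<eta>: "\<eta> > 0" "C * \<eta> = \<epsilon>" using \<open>C > 0\<close> \<open>\<epsilon> > 0\<close> by (simp_all add: \<eta>_def)
  have "uniformly_continuous_on {0..T} v'"
    using cont by (intro compact_uniformly_continuous) auto
  then obtain \<delta> where \<delta>: "\<delta> > 0" "\<And>s t. s \<in> {0..T} \<Longrightarrow> t \<in> {0..T} \<Longrightarrow> dist s t < \<delta> \<Longrightarrow> dist (v' s) (v' t) < \<eta>"
    by (rule uniformly_continuous_onE[of _ _ \<eta>]) (use \<eta> in \<open>auto simp: dist_commute\<close>)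
  \<comment> \<open>The summand \<open>T / \<delta>\<close> makes the step shorter than \<delta>;
    the summand \<open>2 * max \<omega> 0\<close> meets the step size restriction of the Euler
    scheme.\<close>
  obtain n :: nat where n: "T / \<delta> + 2 * max \<omega> 0 + 1 < real n" using reals_Archimedean2 by blast
  have npos: "real n > 0" using n T \<delta>(1) by (smt (verit) divide_nonneg_pos max.cobounded2)
  define h where "h = T / real n"
  have h: "h > 0" "real n * h = T" using npos T by (simp_all add: h_def)
  have "h < \<delta>"
    using n npos \<delta>(1) T unfolding h_def by (simp add: field_simps) (smt (verit) max.cobounded2 mult_pos_pos mult_nonneg_nonneg)
  have hw: "h * max \<omega> 0 \<le> 1/2"
  proof -
    have "2 * max \<omega> 0 \<le> real n" using n T \<delta>(1) by (smt (verit) divide_nonneg_pos)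
    then have "T * (2 * max \<omega> 0) \<le> 1 * real n" using T by (intro mult_mono) auto
    then show ?thesis using npos unfolding h_def by (simp add: field_simps)
  qed
  define R where "R = (\<lambda>x. resolvent D A (1/h) ((1/h) *\<^sub>R x))"
  define t where "t i = real i * h" for i
  have t: "t i \<in> {0..T}" if "i \<le> n" for i
    using that h npos T unfolding t_def by (auto simp flip: h(2) intro!: mult_right_mono)
  have ts: "t (Suc i) = t i + h" for i unfolding t_def by (simp add: algebra_simps)
  \<comment> \<open>By the differential equation, \<open>v (t i) + e i\<close> equals
    \<open>v (t (Suc i)) - h *\<^sub>R A (v (t (Suc i)))\<close>, so one Euler step maps it to
    \<open>v (t (Suc i))\<close>.\<close>
  define e where "e i = h *\<^sub>R k (t (Suc i)) + (v (t (Suc i)) - v (t i) - h *\<^sub>R v' (t (Suc i)))" for i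
  have "norm (v (t n)) \<le> C * (norm (v (t 0)) + real n * (h * (c + \<eta>)))"
  proof (rule norm_perturbed_iteration_le[where v = "\<lambda>i. v (t i)" and e = e])
    show "linear R" unfolding R_def by (rule euler_step_linear[OF HY h(1) hw])
    show "v (t (Suc i)) = R (v (t i) + e i)" if "i < n" for i
    proof -
      have "t (Suc i) \<in> {0..T}" using t[of "Suc i"] that by simp
      then have "v (t i) + e i = v (t (Suc i)) - h *\<^sub>R A (v (t (Suc i)))" "v (t (Suc i)) \<in> D"
        using eq v by (simp_all add: e_def algebra_simps)
      then show ?thesis using euler_step_inverse[OF HY h(1) hw] unfolding R_def by simp
    qed
    show "norm (e i) \<le> h * (c + \<eta>)" if "i < n" for i
    proof -
      have ti: "t i \<in> {0..T}" "t (Suc i) \<in> {0..T}" using t[of i] t[of "Suc i"] that by auto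
      have "norm (v (t (Suc i)) - v (t i) - (t (Suc i) - t i) *\<^sub>R v' (t (Suc i))) \<le> norm (t (Suc i) - t i) * \<eta>"
      proof (rule vector_differentiable_bound_linearization)
        fix x assume x: "x \<in> {t i..t (Suc i)}"
        then have "x \<in> {0..T}" using ti by auto
        then show "(v has_vector_derivative v' x) (at x within {t i..t (Suc i)})"
          using deriv ti by (meson has_vector_derivative_within_subset atLeastatMost_subset_iff atLeastAtMost_iff)
        have "dist x (t (Suc i)) < \<delta>" using x \<open>h < \<delta>\<close> unfolding ts dist_real_def by auto
        then show "norm (v' x - v' (t (Suc i))) \<le> \<eta>"
          using \<delta>(2)[OF \<open>x \<in> {0..T}\<close> ti(2)] by (simp add: dist_norm)
      qed (use h(1) ts[of i] in \<open>auto simp: closed_segment_eq_real_ivl\<close>)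
      then have "norm (v (t (Suc i)) - v (t i) - h *\<^sub>R v' (t (Suc i))) \<le> h * \<eta>"
        using ts[of i] h(1) by simp
      moreover have "norm (h *\<^sub>R k (t (Suc i))) \<le> h * c" using k[OF ti(2)] h(1) by simp
      ultimately show ?thesis unfolding e_def by (simp add: norm_triangle_le distrib_left)
    qed
    show "norm ((R ^^ j) x) \<le> C * norm x" if "j \<le> n" for j x
    proof -
      have "h * real j \<le> 1" using that h T by (smt (verit) mult.commute mult_left_mono of_nat_le_iff)
      then have "2 * max \<omega> 0 * (h * real j) \<le> 2 * max \<omega> 0 * 1"
        by (intro mult_left_mono) auto
      then have "M * exp (2 * max \<omega> 0 * h * real j) \<le> C"
        unfolding C_def using \<open>M \<ge> 1\<close> by (simp add: mult.assoc)
      then show ?thesis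
        using norm_euler_step_power_le[OF HY h(1) hw, of j x] unfolding R_def
        by (meson mult_right_mono norm_ge_zero order_trans)
    qed
  qed (use \<open>C > 0\<close> in simp)
  also have "real n * (h * (c + \<eta>)) = T * c + T * \<eta>" using h(2) by (simp add: algebra_simps)
  also have "C * (norm (v (t 0)) + (T * c + T * \<eta>)) \<le> C * (norm (v (t 0)) + T * c) + C * \<eta>"
    using T \<eta>(1) \<open>C > 0\<close> by (simp add: distrib_left)
  finally show "norm (v T) \<le> M * exp (2 * max \<omega> 0) * (norm (v 0) + T * c) + \<epsilon>"
    using h(2) \<eta>(2) unfolding t_def C_def by simp
qed

section \<open>From strict to integrated solutions by averaging\<close>

lemma integral_diff_Icc:
  fixes w :: "real \<Rightarrow> 'a::banach"
  assumes "continuous_on {0..} w" "0 \<le> s" "s \<le> t"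
  shows "integral {0..t} w - integral {0..s} w = integral {s..t} w"
proof -
  have "w integrable_on {0..t}"
    by (intro integrable_continuous_real continuous_on_subset[OF assms(1)]) auto
  then have "integral {0..s} w + integral {s..t} w = integral {0..t} w"
    using assms by (intro Henstock_Kurzweil_Integration.integral_combine) auto
  then show ?thesis by (simp add: algebra_simps)
qed

text \<open>The mean of \<open>w\<close> over a short interval starting at \<open>t\<close> differs
  from \<open>w t\<close> by at most the oscillation there. Averages are taken forward because
  \<open>w\<close> is controlled only on \<open>{0..}\<close>.\<close>

lemma forward_average_tendsto:
  fixes w :: "real \<Rightarrow> 'a::banach"
  assumes w: "continuous_on {0..} w" and "0 \<le> t"
  shows "((\<lambda>h. (1/h) *\<^sub>R (integral {0..t + h} w - integral {0..t} w)) \<longlongrightarrow> w t) (at_right 0)"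
proof (rule tendstoI)
  fix e :: real assume "e > 0"
  then obtain d where d: "d > 0" "\<And>s. s \<in> {0..} \<Longrightarrow> dist s t < d \<Longrightarrow> dist (w s) (w t) < e/2"
    using w \<open>0 \<le> t\<close> unfolding continuous_on_iff by (metis atLeast_iff half_gt_zero)
  show "\<forall>\<^sub>F h in at_right 0. dist ((1/h) *\<^sub>R (integral {0..t + h} w - integral {0..t} w)) (w t) < e"
    unfolding eventually_at_right_field
  proof (intro exI[of _ d] conjI allI impI d)
    fix h :: real assume h: "0 < h" "h < d"
    have wc: "continuous_on {t..t+h} w" by (rule continuous_on_subset[OF w]) (use \<open>0 \<le> t\<close> in auto)
    have "norm (integral {t..t+h} (\<lambda>s. w s - w t)) \<le> e/2 * (t + h - t)"
      using h d \<open>0 \<le> t\<close>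
      by (intro integral_bound continuous_intros wc) (auto simp: dist_norm dist_real_def intro!: less_imp_le)
    moreover have "integral {t..t+h} (\<lambda>s. w s - w t) = integral {t..t+h} w - h *\<^sub>R w t"
      using h wc by (subst Henstock_Kurzweil_Integration.integral_diff)
        (auto intro!: integrable_continuous_real)
    ultimately have *: "norm (integral {t..t+h} w - h *\<^sub>R w t) \<le> e/2 * h" by simp
    have "(1/h) *\<^sub>R integral {t..t+h} w - w t = (1/h) *\<^sub>R (integral {t..t+h} w - h *\<^sub>R w t)"
      using h by (simp add: algebra_simps)
    then have "norm ((1/h) *\<^sub>R integral {t..t+h} w - w t) = norm (integral {t..t+h} w - h *\<^sub>R w t) / h"
      using h by simp
    then have "norm ((1/h) *\<^sub>R integral {t..t+h} w - w t) \<le> e/2"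
      using * h by (simp add: pos_divide_le_eq)
    then show "dist ((1/h) *\<^sub>R (integral {0..t + h} w - integral {0..t} w)) (w t) < e"
      using integral_diff_Icc[OF w, of t "t + h"] \<open>0 \<le> t\<close> h \<open>e > 0\<close> by (simp add: dist_norm)
  qed
qed

text \<open>The forward averages of an integrated solution are strict solutions, whose data converge back
  as the averaging length tends to \<open>0\<close>.\<close>

lemma integrated_solution_bound:
  fixes w g :: "real \<Rightarrow> 'a::banach"
  assumes HY: "hille_yosida D A \<omega> M" and T: "0 \<le> T" "T < T'" "T \<le> 1"
    and w: "continuous_on {0..} w" and g: "continuous_on {0..} g"
    and sol: "\<And>t. t \<ge> 0 \<Longrightarrow> integral {0..t} w \<in> D"
      "\<And>t. t \<ge> 0 \<Longrightarrow> w t = A (integral {0..t} w) + integral {0..t} g"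
    and c: "\<And>t. t \<in> {0..T'} \<Longrightarrow> norm (g t) \<le> c"
  shows "norm (w T) \<le> M * exp (2 * max \<omega> 0) * (T * c)"
proof -
  have D: "subspace D" and A: "linear_op_on D A" using HY unfolding hille_yosida_def by auto
  note A_diff = linear_op_on_diff_arg[OF A D]
  have "A 0 = 0" using linear_op_on_0[OF A subspace_0[OF D]] .
  then have w0: "w 0 = 0" using sol(2)[of 0] by simp
  show ?thesis
  proof (cases "T = 0")
    case True
    then show ?thesis using w0 by simp
  next
    case False
    then have "T > 0" using T by simp
    define W where "W t = integral {0..t} w" for t
    define v where "v h t = (1/h) *\<^sub>R (W (t + h) - W t)" for h t
    define C where "C = M * exp (2 * max \<omega> 0)"
    \<comment> \<open>Averages up to time \<open>T\<close> involve values up to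
      \<open>T + h\<close>; hence the bound on \<open>g\<close> up to \<open>T'\<close> and the
      restriction on \<open>h\<close>.\<close>
    have bound: "norm (v h T) \<le> C * (norm (v h 0) + T * c)" if h: "0 < h" "h < T' - T" for h
      unfolding C_def
    proof (rule strict_solution_bound[OF HY \<open>T > 0\<close> T(3)])
      fix t assume t: "t \<in> {0..T}"
      have WD: "W (t + h) \<in> D" "W t \<in> D" using sol(1) t h unfolding W_def by auto
      then show "v h t \<in> D" unfolding v_def using D by (intro subspace_scale subspace_diff)
      have W': "(W has_vector_derivative w s) (at s within {0..T'})" if "s \<in> {0..T'}" for s
        unfolding W_def[abs_def]
        by (rule integral_has_vector_derivative) (use that in \<open>auto intro: continuous_on_subset[OF w]\<close>)
      have 1: "(W has_vector_derivative w t) (at t within {0..T})"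
        using t T by (intro has_vector_derivative_within_subset[OF W']) auto
      have "((W \<circ> (\<lambda>s. s + h)) has_vector_derivative 1 *\<^sub>R w (t + h)) (at t within {0..T})"
        using t T h
        by (intro vector_diff_chain_within has_vector_derivative_within_subset[OF W'])
          (auto intro!: derivative_eq_intros)
      then have 2: "((\<lambda>s. W (s + h)) has_vector_derivative w (t + h)) (at t within {0..T})"
        by (simp add: o_def)
      show "(v h has_vector_derivative (1/h) *\<^sub>R (w (t + h) - w t)) (at t within {0..T})"
        unfolding v_def[abs_def]
        by (intro has_vector_derivative_scaleR[of "\<lambda>_. 1/h" 0, simplified]
            bounded_linear.has_vector_derivative[OF bounded_linear_scaleR_right]
            has_vector_derivative_diff 1 2)
      \<comment> \<open>Subtracting the integrated equations at \<open>t + h\<close> and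
        \<open>t\<close> cancels nothing but the past: the new inhomogeneity is the average of
        \<open>g\<close>, again bounded by \<open>c\<close>.\<close>
      show "(1/h) *\<^sub>R (w (t + h) - w t) =
          A (v h t) + (1/h) *\<^sub>R (integral {0..t+h} g - integral {0..t} g)"
      proof -
        have "A (v h t) = (1/h) *\<^sub>R (A (W (t + h)) - A (W t))"
          unfolding v_def using A WD subspace_diff[OF D WD] A_diff[OF WD]
          unfolding linear_op_on_def by simp
        then show ?thesis
          using sol(2)[of t] sol(2)[of "t + h"] t h unfolding W_def by (simp add: algebra_simps)
      qed
      have "norm (integral {t..t+h} g) \<le> c * (t + h - t)"
        using t h T by (intro integral_bound continuous_on_subset[OF g] c) auto
      then show "norm ((1/h) *\<^sub>R (integral {0..t+h} g - integral {0..t} g)) \<le> c"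
        using integral_diff_Icc[OF g, of t "t + h"] t h by (simp add: field_simps)
    next
      show "continuous_on {0..T} (\<lambda>t. (1/h) *\<^sub>R (w (t + h) - w t))"
        using h T
        by (intro continuous_intros continuous_on_subset[OF w] continuous_on_compose2[OF w]) auto
    qed
    have "norm (w T) \<le> C * (norm (w 0) + T * c)"
    proof (rule tendsto_le)
      show "((\<lambda>h. norm (v h T)) \<longlongrightarrow> norm (w T)) (at_right 0)"
        unfolding v_def W_def by (intro tendsto_norm forward_average_tendsto[OF w T(1)])
      have "((\<lambda>h. v h 0) \<longlongrightarrow> w 0) (at_right 0)"
        unfolding v_def W_def by (rule forward_average_tendsto[OF w order_refl])
      then show "((\<lambda>h. C * (norm (v h 0) + T * c)) \<longlongrightarrow> C * (norm (w 0) + T * c)) (at_right 0)"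
        by (intro tendsto_intros)
      show "\<forall>\<^sub>F h in at_right 0. norm (v h T) \<le> C * (norm (v h 0) + T * c)"
        unfolding eventually_at_right_field using bound T by (intro exI[of _ "T' - T"]) auto
    qed simp
    then show ?thesis using w0 unfolding C_def by simp
  qed
qed

text \<open>The previous bound, used at times \<open>s < T\<close> with \<open>T\<close> in the role
  of \<open>T'\<close>, passes to the limit from the left. The absorption argument below needs this
  form, as its maximum point may be the right end of the interval on which the inhomogeneity is
  controlled.\<close>

lemma integrated_solution_bound_closed:
  fixes w g :: "real \<Rightarrow> 'a::banach"
  assumes HY: "hille_yosida D A \<omega> M" and T: "0 \<le> T" "T \<le> 1"
    and w: "continuous_on {0..} w" and g: "continuous_on {0..} g"
    and sol: "\<And>t. t \<ge> 0 \<Longrightarrow> integral {0..t} w \<in> D"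
      "\<And>t. t \<ge> 0 \<Longrightarrow> w t = A (integral {0..t} w) + integral {0..t} g"
    and c: "\<And>t. t \<in> {0..T} \<Longrightarrow> norm (g t) \<le> c"
  shows "norm (w T) \<le> M * exp (2 * max \<omega> 0) * (T * c)"
proof (cases "T = 0")
  case True
  have "A 0 = 0"
    using HY linear_op_on_0[of D A] unfolding hille_yosida_def by (meson subspace_0)
  then show ?thesis using True sol(2)[of 0] by simp
next
  case False
  then have "T > 0" using T by simp
  have "norm (g 0) \<le> c" using c \<open>T > 0\<close> by simp
  then have "c \<ge> 0" using norm_ge_zero order_trans by blast
  have "M \<ge> 0" using HY unfolding hille_yosida_def by simp
  show ?thesis
  proof (rule tendsto_upperbound)
    have "continuous_on {0..T} w" by (rule continuous_on_subset[OF w]) auto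
    then have "(w \<longlongrightarrow> w T) (at T within {0..T})" using \<open>T > 0\<close> unfolding continuous_on_def by simp
    then have "(w \<longlongrightarrow> w T) (at_left T)" using at_within_Icc_at_left[OF \<open>T > 0\<close>] by simp
    then show "((\<lambda>s. norm (w s)) \<longlongrightarrow> norm (w T)) (at_left T)" by (rule tendsto_norm)
    have "norm (w s) \<le> M * exp (2 * max \<omega> 0) * (T * c)" if "0 < s" "s < T" for s
    proof -
      have "norm (w s) \<le> M * exp (2 * max \<omega> 0) * (s * c)"
        using that T c by (intro integrated_solution_bound[OF HY _ \<open>s < T\<close> _ w g sol]) auto
      also have "\<dots> \<le> M * exp (2 * max \<omega> 0) * (T * c)"
        using that \<open>c \<ge> 0\<close> \<open>M \<ge> 0\<close> by (intro mult_left_mono mult_right_mono) auto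
      finally show ?thesis .
    qed
    then show "\<forall>\<^sub>F s in at_left T. norm (w s) \<le> M * exp (2 * max \<omega> 0) * (T * c)"
      unfolding eventually_at_left_field using \<open>T > 0\<close> by blast
  qed simp
qed

section \<open>Almost periodic families of operators\<close>

lemma op_dist_bound:
  assumes S: "subspace S" and F: "almost_periodic (op_metric S) F" and "x \<in> S"
    and "op_dist S (F s) (F t) < e"
  shows "norm (F s x - F t x) \<le> e * norm x"
proof -
  have F': "F r \<in> bounded_ops S" for r
    using F continuous_map_realD(1)[of "op_metric S" F r] S unfolding almost_periodic_def by simp
  have "norm (F s x - F t x) \<le> op_dist S (F s) (F t) * norm x"
    using onorm_on[OF bounded_linear_on_diff \<open>x \<in> S\<close>, of "F s" "F t"] F'[of s] F'[of t]
    unfolding op_dist_def bounded_ops_def by simp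
  also have "\<dots> \<le> e * norm x" using assms(4) by (intro mult_right_mono) auto
  finally show ?thesis .
qed

lemma almost_periodic_op_linear:
  assumes "subspace S" and "almost_periodic (op_metric S) F"
  shows "bounded_linear_on S (F t)"
  using assms continuous_map_realD(1)[of "op_metric S" F t]
  unfolding almost_periodic_def by (simp add: bounded_ops_def)

lemma bounded_linear_on_diff_arg:
  assumes "bounded_linear_on S T" "subspace S" "x \<in> S" "y \<in> S"
  shows "T (x - y) = T x - T y"
  using assms linear_op_on_diff_arg unfolding bounded_linear_on_def by blast

text \<open>Distances to \<open>F 0\<close> are bounded by almost periodicity, and
  \<open>F 0\<close> is itself bounded; together this gives one operator bound for all
  times.\<close>

lemma almost_periodic_op_bounded:
  assumes S: "subspace S" and F: "almost_periodic (op_metric S) F"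
  shows "\<exists>b\<ge>0. \<forall>t. \<forall>x\<in>S. norm (F t x) \<le> b * norm x"
proof -
  obtain B where B: "\<And>t. op_dist S (F t) (F 0) \<le> B"
    using almost_periodic_bounded[OF F] S by auto
  obtain C where C: "\<And>x. x \<in> S \<Longrightarrow> norm (F 0 x) \<le> C * norm x"
    using almost_periodic_op_linear[OF S F, of 0] unfolding bounded_linear_on_def by blast
  have "norm (F t x) \<le> \<bar>B + 1 + C\<bar> * norm x" if "x \<in> S" for t x
  proof -
    have "op_dist S (F t) (F 0) < B + 1" using B[of t] by simp
    from op_dist_bound[OF S F that this]
    have "norm (F t x) \<le> (B + 1 + C) * norm x"
      using C[OF that] norm_triangle_sub[of "F t x" "F 0 x"] by (simp add: algebra_simps)
    also have "\<dots> \<le> \<bar>B + 1 + C\<bar> * norm x" by (intro mult_right_mono) auto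
    finally show ?thesis .
  qed
  then show ?thesis by (meson abs_ge_zero)
qed

text \<open>The increment is split at \<open>F (a + s) (u r)\<close>: the uniform operator bound
  handles the change of \<open>u\<close>, norm continuity of \<open>F\<close> the change of time.
  This makes the forcing terms of the mild equation continuous.\<close>

lemma continuous_on_almost_periodic_op:
  assumes S: "subspace S" and F: "almost_periodic (op_metric S) F"
    and u: "continuous_on T u" "u \<in> T \<rightarrow> S"
  shows "continuous_on T (\<lambda>r. F (a + r) (u r))"
  unfolding continuous_on_def
proof
  fix r assume r: "r \<in> T"
  obtain b where b: "\<And>t x. x \<in> S \<Longrightarrow> norm (F t x) \<le> b * norm x"
    using almost_periodic_op_bounded[OF S F] by blast
  have c: "continuous_map euclidean (mtopology_of (op_metric S)) F"
    using F unfolding almost_periodic_def by blast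
  have "((\<lambda>s. op_dist S (F (a + s)) (F (a + r))) \<longlongrightarrow> 0) (at r within T)"
  proof (rule tendstoI)
    fix e :: real assume "e > 0"
    then obtain d where "d > 0" "\<And>s. dist s (a + r) < d \<Longrightarrow> mdist (op_metric S) (F s) (F (a + r)) < e"
      using continuous_map_realD(2)[OF c] by blast
    moreover have "op_dist S T R \<ge> 0" for T R :: "'a \<Rightarrow> 'b"
      using Metric_space.nonneg[OF Metric_space_bounded_ops[OF S]] .
    ultimately show "\<forall>\<^sub>F s in at r within T. dist (op_dist S (F (a + s)) (F (a + r))) 0 < e"
      unfolding eventually_at using S by (intro exI[of _ d]) (auto simp: dist_real_def)
  qed
  moreover have "(u \<longlongrightarrow> u r) (at r within T)" using u(1) r unfolding continuous_on_def by blast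
  ultimately have "((\<lambda>s. b * norm (u s - u r) + op_dist S (F (a + s)) (F (a + r)) * norm (u r)) \<longlongrightarrow>
      b * norm (u r - u r) + 0 * norm (u r)) (at r within T)"
    by (intro tendsto_intros)
  then have lim: "((\<lambda>s. b * norm (u s - u r) + op_dist S (F (a + s)) (F (a + r)) * norm (u r)) \<longlongrightarrow> 0) (at r within T)"
    by simp
  have le: "norm (F (a + s) (u s) - F (a + r) (u r))
      \<le> b * norm (u s - u r) + op_dist S (F (a + s)) (F (a + r)) * norm (u r)" if "s \<in> T" for s
  proof -
    have uS: "u s \<in> S" "u r \<in> S" using u(2) that r by auto
    have F': "bounded_linear_on S (F q)" "F q \<in> bounded_ops S" for q
      using continuous_map_realD(1)[OF c, of q] almost_periodic_op_linear[OF S F] S by auto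
    have "norm (F (a + s) (u s) - F (a + s) (u r)) \<le> b * norm (u s - u r)"
      using b[OF subspace_diff[OF S uS]] bounded_linear_on_diff_arg[OF F'(1) S uS] by metis
    moreover have "norm (F (a + s) (u r) - F (a + r) (u r)) \<le> op_dist S (F (a + s)) (F (a + r)) * norm (u r)"
      using onorm_on[OF bounded_linear_on_diff[OF F'(1) F'(1)] uS(2), of "a + s" "a + r"] F'(2)
      unfolding op_dist_def by simp
    ultimately show ?thesis
      using norm_triangle_ineq[of "F (a + s) (u s) - F (a + s) (u r)" "F (a + s) (u r) - F (a + r) (u r)"]
      by simp
  qed
  have "((\<lambda>s. F (a + s) (u s) - F (a + r) (u r)) \<longlongrightarrow> 0) (at r within T)"
    by (rule Lim_null_comparison[OF _ lim]) (auto simp: eventually_at_filter intro!: always_eventually le)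
  then show "((\<lambda>s. F (a + s) (u s)) \<longlongrightarrow> F (a + r) (u r)) (at r within T)"
    using Lim_null by blast
qed

section \<open>The evolution semigroup\<close>

lemma subspace_closure:
  fixes S :: "'a::real_normed_vector set"
  assumes "subspace S"
  shows "subspace (closure S)"
  unfolding subspace_def
proof (intro conjI ballI allI)
  show "0 \<in> closure S" using subspace_0[OF assms] closure_subset by blast
next
  fix x y assume "x \<in> closure S" "y \<in> closure S"
  then obtain f g where "\<forall>n. f n \<in> S" "f \<longlonglongrightarrow> x" "\<forall>n. g n \<in> S" "g \<longlonglongrightarrow> y"
    unfolding closure_sequential by blast
  then have "\<forall>n. f n + g n \<in> S" "(\<lambda>n. f n + g n) \<longlonglongrightarrow> x + y"
    using subspace_add[OF assms] by (auto intro: tendsto_add)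
  then show "x + y \<in> closure S"
    unfolding closure_sequential by (intro exI[of _ "\<lambda>n. f n + g n"] conjI)
next
  fix c :: real and x assume "x \<in> closure S"
  then obtain f where "\<forall>n. f n \<in> S" "f \<longlonglongrightarrow> x"
    unfolding closure_sequential by blast
  then have "\<forall>n. c *\<^sub>R f n \<in> S" "(\<lambda>n. c *\<^sub>R f n) \<longlonglongrightarrow> c *\<^sub>R x"
    using subspace_scale[OF assms] by (auto intro: tendsto_scaleR)
  then show "c *\<^sub>R x \<in> closure S"
    unfolding closure_sequential by (intro exI[of _ "\<lambda>n. c *\<^sub>R f n"] conjI)
qed

section \<open>Bounds for the evolution family and its translates\<close>

locale almost_periodic_evolution =
  fixes D X0 :: "'a::banach set"
    and A :: "'a \<Rightarrow> 'a"
    and F V :: "real \<Rightarrow> 'a \<Rightarrow> 'a"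
    and U :: "real \<Rightarrow> real \<Rightarrow> 'a \<Rightarrow> 'a"
    and \<omega>A MA :: real
  assumes HY: "hille_yosida D A \<omega>A MA"
    and X0: "X0 = closure D"
    and F_AP: "almost_periodic (op_metric X0) F"
    and V_AP: "almost_periodic (op_metric X0) V"
    and U_evol: "exp_bounded_evolution_family X0 U"
    and U_sol: "solution_family D A F V U"
begin

lemma subspace_X0: "subspace X0"
  using HY unfolding X0 hille_yosida_def by (auto intro: subspace_closure)

lemma closed_X0: "closed X0"
  unfolding X0 by simp

lemma U_in_X0: "s \<le> t \<Longrightarrow> x \<in> X0 \<Longrightarrow> U t s x \<in> X0"
  using U_evol unfolding exp_bounded_evolution_family_def by blast

lemma U_bounded_linear: "s \<le> t \<Longrightarrow> bounded_linear_on X0 (U t s)"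
  using U_evol unfolding exp_bounded_evolution_family_def by blast

lemma U_refl: "x \<in> X0 \<Longrightarrow> U s s x = x"
  using U_evol unfolding exp_bounded_evolution_family_def by blast

lemma U_comp: "s \<le> r \<Longrightarrow> r \<le> t \<Longrightarrow> x \<in> X0 \<Longrightarrow> U t r (U r s x) = U t s x"
  using U_evol unfolding exp_bounded_evolution_family_def by blast

lemma U_continuous: "x \<in> X0 \<Longrightarrow> continuous_on {(t, s). s \<le> t} (\<lambda>(t, s). U t s x)"
  using U_evol unfolding exp_bounded_evolution_family_def by blast

text \<open>Taking absolute values makes both constants nonnegative, so the bound increases with the
  elapsed time.\<close>

lemma U_exp_bound:
  obtains M w where "M \<ge> 0" "w \<ge> 0"
    "\<And>s t x. s \<le> t \<Longrightarrow> x \<in> X0 \<Longrightarrow> norm (U t s x) \<le> M * exp (w * (t - s)) * norm x"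
proof -
  have "\<exists>M w. \<forall>t s. s \<le> t \<longrightarrow> onorm_on X0 (U t s) \<le> M * exp (w * (t - s))"
    using U_evol unfolding exp_bounded_evolution_family_def by (elim conjE)
  then obtain M w where M: "\<And>s t. s \<le> t \<Longrightarrow> onorm_on X0 (U t s) \<le> M * exp (w * (t - s))"
    by blast
  have "norm (U t s x) \<le> \<bar>M\<bar> * exp (\<bar>w\<bar> * (t - s)) * norm x" if "s \<le> t" "x \<in> X0" for s t x
  proof -
    have "norm (U t s x) \<le> onorm_on X0 (U t s) * norm x"
      using onorm_on[OF U_bounded_linear] that by blast
    also have "\<dots> \<le> \<bar>M\<bar> * exp (\<bar>w\<bar> * (t - s)) * norm x"
    proof (rule mult_right_mono)
      have "M * exp (w * (t - s)) \<le> \<bar>M\<bar> * exp (\<bar>w\<bar> * (t - s))"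
        using that by (intro mult_mono) (auto intro!: mult_right_mono)
      then show "onorm_on X0 (U t s) \<le> \<bar>M\<bar> * exp (\<bar>w\<bar> * (t - s))"
        using M[OF that(1)] by simp
    qed simp
    finally show ?thesis .
  qed
  then show thesis using that[of "\<bar>M\<bar>" "\<bar>w\<bar>"] by auto
qed

lemma U_unit_time_bound:
  obtains P where "P \<ge> 0"
    "\<And>s t x. 0 \<le> t \<Longrightarrow> t \<le> 1 \<Longrightarrow> x \<in> X0 \<Longrightarrow> norm (U (s + t) s x) \<le> P * norm x"
proof -
  obtain M w where M: "M \<ge> 0" "w \<ge> 0"
    "\<And>s t x. s \<le> t \<Longrightarrow> x \<in> X0 \<Longrightarrow> norm (U t s x) \<le> M * exp (w * (t - s)) * norm x"
    by (rule U_exp_bound) blast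
  have "norm (U (s + t) s x) \<le> M * exp w * norm x" if "0 \<le> t" "t \<le> 1" "x \<in> X0" for s t x
  proof -
    have "norm (U (s + t) s x) \<le> M * exp (w * t) * norm x" using M(3)[of s "s + t" x] that by simp
    also have "\<dots> \<le> M * exp w * norm x"
      using M(1,2) that by (intro mult_right_mono mult_left_mono) (auto intro: mult_left_le)
    finally show ?thesis .
  qed
  then show thesis using that[of "M * exp w"] M(1) by auto
qed

text \<open>Measuring time from the start puts solutions with different starting times on the same
  half-line, where they can be subtracted.\<close>

lemma shifted_mild_solution:
  fixes s :: real
  assumes "x \<in> X0"
  defines "u \<equiv> \<lambda>r. U (s + r) s x"
  shows "continuous_on {0..} u" "u \<in> {0..} \<rightarrow> X0"
    "\<And>t. t \<ge> 0 \<Longrightarrow> integral {0..t} u \<in> D"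
    "\<And>t. t \<ge> 0 \<Longrightarrow> u t = x + A (integral {0..t} u) + integral {0..t} (\<lambda>r. F (s + r) (u r) - V (s + r) (u r))"
proof -
  have sol: "mild_solution D A F V s x (\<lambda>t. U t s x)"
    using U_sol \<open>x \<in> X0\<close> unfolding solution_family_def X0 by blast
  then have "continuous_on {s..} (\<lambda>t. U t s x)" unfolding mild_solution_def by blast
  then show "continuous_on {0..} u"
    unfolding u_def by (rule continuous_on_compose2) (auto intro!: continuous_intros)
  show "u \<in> {0..} \<rightarrow> X0" unfolding u_def using U_in_X0 \<open>x \<in> X0\<close> by auto
  fix t :: real assume t: "t \<ge> 0"
  have 1: "integral {0..t} u = integral {s..s+t} (\<lambda>t. U t s x)"
    using integral_shift_Icc_real[of 0 t "\<lambda>t. U t s x" s] by (simp add: u_def o_def add.commute)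
  have 2: "integral {0..t} (\<lambda>r. F (s + r) (u r) - V (s + r) (u r)) =
      integral {s..s+t} (\<lambda>r. F r (U r s x) - V r (U r s x))"
    using integral_shift_Icc_real[of 0 t "\<lambda>r. F r (U r s x) - V r (U r s x)" s]
    by (simp add: u_def o_def add.commute)
  show "integral {0..t} u \<in> D"
    using sol t unfolding 1 mild_solution_def by simp
  have "U (s + t) s x = x + A (integral {s..s+t} (\<lambda>t. U t s x)) +
      integral {s..s+t} (\<lambda>r. F r (U r s x) - V r (U r s x))"
    using sol t unfolding mild_solution_def by simp
  then show "u t = x + A (integral {0..t} u) + integral {0..t} (\<lambda>r. F (s + r) (u r) - V (s + r) (u r))"
    unfolding 1 2 by (simp add: u_def)
qed

abbreviation FV_periods :: "real \<Rightarrow> real set" where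
  "FV_periods e \<equiv> almost_periods (op_metric X0) F e \<inter> almost_periods (op_metric X0) V e"

text \<open>The difference of a solution and its translate starts at \<open>0\<close>, so on a short interval the
  term \<open>(F - V) w\<close> in its equation can be absorbed, which makes Gronwall's inequality unnecessary.\<close>

lemma U_translation_bound:
  obtains t0 C where "0 < t0" "t0 \<le> 1" "C \<ge> 0"
    "\<And>e \<tau> s t x. \<tau> \<in> FV_periods e \<Longrightarrow> 0 \<le> t \<Longrightarrow> t \<le> t0 \<Longrightarrow> x \<in> X0 \<Longrightarrow>
       norm (U (s + \<tau> + t) (s + \<tau>) x - U (s + t) s x) \<le> C * e * norm x"
proof -
  obtain bF where bF: "bF \<ge> 0" "\<And>t x. x \<in> X0 \<Longrightarrow> norm (F t x) \<le> bF * norm x"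
    using almost_periodic_op_bounded[OF subspace_X0 F_AP] by blast
  obtain bV where bV: "bV \<ge> 0" "\<And>t x. x \<in> X0 \<Longrightarrow> norm (V t x) \<le> bV * norm x"
    using almost_periodic_op_bounded[OF subspace_X0 V_AP] by blast
  obtain P where P: "P \<ge> 0"
    "\<And>s t x. 0 \<le> t \<Longrightarrow> t \<le> 1 \<Longrightarrow> x \<in> X0 \<Longrightarrow> norm (U (s + t) s x) \<le> P * norm x"
    by (rule U_unit_time_bound) blast
  define K where "K = MA * exp (2 * max \<omega>A 0)"
  have "K \<ge> 0" using HY unfolding K_def hille_yosida_def by simp
  define b where "b = bF + bV"
  have "b \<ge> 0" using bF bV unfolding b_def by simp
  \<comment> \<open>With \<open>K\<close> the a priori constant and \<open>b\<close> a bound for the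
    operators \<open>F t - V t\<close>, this choice gives \<open>K * b * t0 \<le> 1/2\<close> and
    also \<open>t0 \<le> 1\<close>.\<close>
  define t0 where "t0 = 1 / (2 * (K * b + 1))"
  have Kb: "K * b \<ge> 0" using \<open>K \<ge> 0\<close> \<open>b \<ge> 0\<close> by simp
  have t0: "0 < t0" "t0 \<le> 1" "K * b * t0 \<le> 1/2"
    using Kb unfolding t0_def by (simp_all add: divide_simps)
  have "norm (U (s + \<tau> + t) (s + \<tau>) x - U (s + t) s x) \<le> 4 * K * P * e * norm x"
    if \<tau>: "\<tau> \<in> FV_periods e" and t: "0 \<le> t" "t \<le> t0" and x: "x \<in> X0" for e \<tau> s t x
  proof -
    define u1 where "u1 r = U (s + \<tau> + r) (s + \<tau>) x" for r
    define u2 where "u2 r = U (s + r) s x" for r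
    note 1 = shifted_mild_solution[OF x, where s = "s + \<tau>", folded u1_def]
    note 2 = shifted_mild_solution[OF x, where s = s, folded u2_def]
    \<comment> \<open>The initial value cancels in \<open>w\<close>, which thus is an integrated
      solution with inhomogeneity \<open>g\<close>.\<close>
    define w where "w r = u1 r - u2 r" for r
    define g1 where "g1 r = F (s + \<tau> + r) (u1 r) - V (s + \<tau> + r) (u1 r)" for r
    define g2 where "g2 r = F (s + r) (u2 r) - V (s + r) (u2 r)" for r
    define g where "g r = g1 r - g2 r" for r
    have wc: "continuous_on {0..} w" unfolding w_def by (intro continuous_on_diff 1(1) 2(1))
    have gc: "continuous_on {0..} g1" "continuous_on {0..} g2"
      unfolding g1_def g2_def
      by (intro continuous_on_diff continuous_on_almost_periodic_op[OF subspace_X0 F_AP 1(1,2)]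
          continuous_on_almost_periodic_op[OF subspace_X0 V_AP 1(1,2)]
          continuous_on_almost_periodic_op[OF subspace_X0 F_AP 2(1,2)]
          continuous_on_almost_periodic_op[OF subspace_X0 V_AP 2(1,2)])+
    then have gc': "continuous_on {0..} g" unfolding g_def by (intro continuous_on_diff)
    have int: "f integrable_on {0..r}" if "continuous_on {0..} f" for f :: "real \<Rightarrow> 'a" and r
      by (intro integrable_continuous_real continuous_on_subset[OF that]) auto
    have wi: "integral {0..r} w = integral {0..r} u1 - integral {0..r} u2" for r
      unfolding w_def using int 1(1) 2(1) by (intro Henstock_Kurzweil_Integration.integral_diff) auto
    have gi: "integral {0..r} g = integral {0..r} g1 - integral {0..r} g2" for r
      unfolding g_def using int gc by (intro Henstock_Kurzweil_Integration.integral_diff) auto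
    have D: "subspace D" and A: "linear_op_on D A" using HY unfolding hille_yosida_def by auto
    note A_diff = linear_op_on_diff_arg[OF A D]
    have solD: "integral {0..r} w \<in> D" if "r \<ge> 0" for r
      unfolding wi using 1(3) 2(3) that by (intro subspace_diff[OF D])
    have sol: "w r = A (integral {0..r} w) + integral {0..r} g" if "r \<ge> 0" for r
      unfolding wi gi A_diff[OF 1(3)[OF that] 2(3)[OF that]]
      using 1(4)[OF that] 2(4)[OF that] unfolding w_def g1_def[symmetric] g2_def[symmetric] by simp
    \<comment> \<open>At a maximum point of the norm, the a priori estimate has the same quantity
      \<open>S\<close> on both sides.\<close>
    obtain r0 where r0: "r0 \<in> {0..t0}" "\<And>r. r \<in> {0..t0} \<Longrightarrow> norm (w r) \<le> norm (w r0)"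
      using continuous_attains_sup[of "{0..t0}" "\<lambda>r. norm (w r)"] t0(1)
        continuous_on_norm[OF continuous_on_subset[OF wc, of "{0..t0}"]] by auto
    define S where "S = norm (w r0)"
    have gb: "norm (g r) \<le> 2 * e * P * norm x + b * S" if r: "r \<in> {0..r0}" for r
    proof -
      have r': "0 \<le> r" "r \<le> 1" "r \<in> {0..t0}" using r r0(1) t0(2) by auto
      have u: "u1 r \<in> X0" "u2 r \<in> X0" using 1(2) 2(2) r'(1) by auto
      have wX: "w r \<in> X0" unfolding w_def by (rule subspace_diff[OF subspace_X0 u])
      have e: "op_dist X0 (F (s + \<tau> + r)) (F (s + r)) < e" "op_dist X0 (V (s + \<tau> + r)) (V (s + r)) < e"
        using \<tau> subspace_X0 unfolding almost_periods_def by (auto simp: add_ac)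
      have "op_dist X0 (F (s + \<tau> + r)) (F (s + r)) \<ge> 0"
        using Metric_space.nonneg[OF Metric_space_bounded_ops[OF subspace_X0]] .
      then have "e \<ge> 0" using e(1) by simp
      have "norm (u1 r) \<le> P * norm x" unfolding u1_def using P(2) r' x by blast
      then have eP: "e * norm (u1 r) \<le> e * (P * norm x)" using \<open>e \<ge> 0\<close> by (rule mult_left_mono)
      have bS: "bF * norm (w r) \<le> bF * S" "bV * norm (w r) \<le> bV * S"
        unfolding S_def using bF bV r0(2)[OF r'(3)] by (auto intro: mult_left_mono)
      \<comment> \<open>The first two differences are small because \<tau> is an almost period of
        both coefficients; the last term is linear in \<open>w\<close> and contributes at most
        \<open>b * S\<close>.\<close>
      have split: "g r = (F (s + \<tau> + r) (u1 r) - F (s + r) (u1 r)) - (V (s + \<tau> + r) (u1 r) - V (s + r) (u1 r))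
          + (F (s + r) (w r) - V (s + r) (w r))"
        unfolding g_def g1_def g2_def w_def
        using bounded_linear_on_diff_arg[OF almost_periodic_op_linear[OF subspace_X0 F_AP] subspace_X0 u]
          bounded_linear_on_diff_arg[OF almost_periodic_op_linear[OF subspace_X0 V_AP] subspace_X0 u]
        by simp
      have "norm (g r) \<le> (e * norm (u1 r) + e * norm (u1 r)) + (bF * norm (w r) + bV * norm (w r))"
        unfolding split
        by (intro norm_triangle_mono norm_triangle_le_diff[OF add_mono] bF(2) bV(2) wX
            op_dist_bound[OF subspace_X0 F_AP u(1) e(1)] op_dist_bound[OF subspace_X0 V_AP u(1) e(2)])
      then show ?thesis using eP bS unfolding b_def by (simp add: algebra_simps)
    qed
    have "norm (w r0) \<le> MA * exp (2 * max \<omega>A 0) * (r0 * (2 * e * P * norm x + b * S))"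
      using r0(1) t0(2) by (intro integrated_solution_bound_closed[OF HY _ _ wc gc' solD sol gb]) auto
    then have le1: "S \<le> K * (r0 * (2 * e * P * norm x + b * S))" unfolding S_def K_def .
    have "S \<ge> 0" unfolding S_def by simp
    have "0 \<le> e"
    proof -
      have "\<forall>t. op_dist X0 (F (t + \<tau>)) (F t) < e"
        using \<tau> unfolding almost_periods_def by (simp add: subspace_X0)
      then have "op_dist X0 (F (0 + \<tau>)) (F 0) < e" ..
      moreover have "op_dist X0 (F (0 + \<tau>)) (F 0) \<ge> 0"
        using Metric_space.nonneg[OF Metric_space_bounded_ops[OF subspace_X0]] .
      ultimately show ?thesis by simp
    qed
    \<comment> \<open>The choice of \<open>t0\<close> leaves at most \<open>S / 2\<close> on the
      right, which is absorbed into the left side; this doubles the factor 2 to 4.\<close>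
    note le1
    also have "K * (r0 * (2 * e * P * norm x + b * S)) \<le> K * (t0 * (2 * e * P * norm x + b * S))"
      using \<open>K \<ge> 0\<close> r0(1) P(1) \<open>b \<ge> 0\<close> \<open>S \<ge> 0\<close> \<open>e \<ge> 0\<close>
      by (intro mult_left_mono mult_right_mono add_nonneg_nonneg mult_nonneg_nonneg) auto
    also have "\<dots> = t0 * (K * (2 * e * P * norm x)) + (K * b * t0) * S" by (simp add: algebra_simps)
    also have "\<dots> \<le> 1 * (K * (2 * e * P * norm x)) + 1/2 * S"
      using t0 \<open>K \<ge> 0\<close> P(1) \<open>0 \<le> e\<close> \<open>S \<ge> 0\<close>
      by (intro add_mono mult_right_mono mult_nonneg_nonneg) auto
    finally have "S \<le> 4 * K * P * e * norm x" by (simp add: algebra_simps)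
    then show ?thesis using r0(2)[of t] t unfolding S_def w_def u1_def u2_def by simp
  qed
  then show thesis using that[of t0 "4 * K * P"] t0 \<open>K \<ge> 0\<close> P(1) by simp
qed

section \<open>Evolution of almost periodic functions\<close>

text \<open>Strong continuity of \<open>U\<close> concerns a fixed vector; the exponential bound
  pays for replacing that vector by the moving one. The coordinates are elapsed time and starting
  time.\<close>

lemma continuous_on_U_AP:
  assumes "\<phi> \<in> AP X0"
  shows "continuous_on ({0..} \<times> UNIV) (\<lambda>(t, s). U (s + t) s (apply_bcontfun \<phi> s))"
  unfolding continuous_on_def
proof
  fix z :: "real \<times> real" assume "z \<in> {0..} \<times> UNIV"
  then obtain t s where z: "z = (t, s)" "t \<ge> 0" by auto
  obtain M w where M: "M \<ge> 0" "w \<ge> 0"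
    "\<And>s t x. s \<le> t \<Longrightarrow> x \<in> X0 \<Longrightarrow> norm (U t s x) \<le> M * exp (w * (t - s)) * norm x"
    by (rule U_exp_bound) blast
  let ?S = "{0..} \<times> UNIV :: (real \<times> real) set"
  let ?U = "\<lambda>y (x :: 'a). U (snd y + fst y) (snd y) x"
  let ?h = "\<lambda>y. M * exp (w * fst y) * norm (\<phi> (snd y) - \<phi> s) + norm (?U y (\<phi> s) - ?U z (\<phi> s))"
  have "continuous_on ?S (\<lambda>y. case (snd y + fst y, snd y) of (t, s') \<Rightarrow> U t s' (\<phi> s))"
    by (rule continuous_on_compose2[OF U_continuous[OF apply_bcontfun_in_AP_carrier[OF assms]]])
      (auto intro!: continuous_intros)
  then have U: "((\<lambda>y. ?U y (\<phi> s)) \<longlongrightarrow> ?U z (\<phi> s)) (at z within ?S)"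
    using z unfolding continuous_on_def by auto
  have "continuous_on UNIV (\<lambda>y :: real \<times> real. \<phi> (snd y))"
    by (rule continuous_on_compose2[of UNIV "apply_bcontfun \<phi>"]) (auto intro!: continuous_intros)
  then have "((\<lambda>y. \<phi> (snd y)) \<longlongrightarrow> \<phi> (snd z)) (at z within ?S)"
    unfolding continuous_on_def by (meson UNIV_I subset_UNIV tendsto_within_subset)
  then have "(?h \<longlongrightarrow> M * exp (w * fst z) * norm (\<phi> (snd z) - \<phi> s) + norm (?U z (\<phi> s) - ?U z (\<phi> s))) (at z within ?S)"
    by (intro tendsto_intros U)
  then have h: "(?h \<longlongrightarrow> 0) (at z within ?S)" using z by simp
  have le: "norm (?U y (\<phi> (snd y)) - ?U z (\<phi> s)) \<le> ?h y" if "y \<in> ?S" for y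
  proof -
    have y: "snd y \<le> snd y + fst y" using that by auto
    have X: "\<phi> (snd y) \<in> X0" "\<phi> s \<in> X0" using apply_bcontfun_in_AP_carrier[OF assms] by auto
    have "norm (?U y (\<phi> (snd y)) - ?U y (\<phi> s)) \<le> M * exp (w * fst y) * norm (\<phi> (snd y) - \<phi> s)"
      using M(3)[OF y subspace_diff[OF subspace_X0 X]]
        bounded_linear_on_diff_arg[OF U_bounded_linear[OF y] subspace_X0 X] by simp
    then show ?thesis
      using norm_triangle_ineq[of "?U y (\<phi> (snd y)) - ?U y (\<phi> s)" "?U y (\<phi> s) - ?U z (\<phi> s)"] by simp
  qed
  have "((\<lambda>y. ?U y (\<phi> (snd y)) - ?U z (\<phi> s)) \<longlongrightarrow> 0) (at z within ?S)"
    by (rule Lim_null_comparison[OF _ h]) (use le in \<open>auto simp: eventually_at_filter\<close>)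
  then show "((\<lambda>(t, s). U (s + t) s (\<phi> s)) \<longlongrightarrow> (case z of (t, s) \<Rightarrow> U (s + t) s (\<phi> s))) (at z within ?S)"
    using z by (simp add: case_prod_beta' Lim_null[of _ "U (s + t) s (\<phi> s)"])
qed

text \<open>The difference is split at \<open>U (s + t) s (\<phi> (s + \<tau>))\<close>, leaving the
  change of coefficients and the change of \<phi>. The same \<tau> serves all \<open>t\<close> in
  \<open>{0..t0}\<close>; strong continuity later relies on this uniformity.\<close>

lemma U_AP_translation:
  obtains t0 where "0 < t0" "t0 \<le> 1"
    "\<And>\<phi> e. \<phi> \<in> AP X0 \<Longrightarrow> e > 0 \<Longrightarrow>
       relatively_dense {\<tau>. \<forall>s. \<forall>t\<in>{0..t0}.
         norm (U (s + \<tau> + t) (s + \<tau>) (apply_bcontfun \<phi> (s + \<tau>)) - U (s + t) s (apply_bcontfun \<phi> s)) < e}"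
proof -
  obtain t0 C where t0: "0 < t0" "t0 \<le> 1" and C: "C \<ge> 0"
    "\<And>e \<tau> s t x. \<tau> \<in> FV_periods e \<Longrightarrow> 0 \<le> t \<Longrightarrow> t \<le> t0 \<Longrightarrow> x \<in> X0 \<Longrightarrow>
       norm (U (s + \<tau> + t) (s + \<tau>) x - U (s + t) s x) \<le> C * e * norm x"
    by (rule U_translation_bound) blast
  obtain P where P: "P \<ge> 0"
    "\<And>s t x. 0 \<le> t \<Longrightarrow> t \<le> 1 \<Longrightarrow> x \<in> X0 \<Longrightarrow> norm (U (s + t) s x) \<le> P * norm x"
    by (rule U_unit_time_bound) blast
  have "relatively_dense {\<tau>. \<forall>s. \<forall>t\<in>{0..t0}. norm (U (s + \<tau> + t) (s + \<tau>) (\<phi> (s + \<tau>)) - U (s + t) s (\<phi> s)) < e}"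
    (is "relatively_dense ?R") if \<phi>: "\<phi> \<in> AP X0" and "e > 0" for \<phi> e
  proof -
    let ?P\<phi> = "almost_periods (submetric euclidean_metric X0) (apply_bcontfun \<phi>)"
    \<comment> \<open>Tolerance \<open>e/c\<close> yields a total error of
      \<open>(c - 1) * (e/c)\<close>; the added 1 makes this strictly less than \<open>e\<close> and
      keeps \<open>c\<close> positive.\<close>
    define c where "c = C * norm \<phi> + P + 1"
    have c: "c > 0" using C(1) P(1) unfolding c_def by (simp add: add_nonneg_pos)
    have "bohr_family (\<lambda>e. FV_periods e \<inter> ?P\<phi> e)"
      using \<phi> F_AP V_AP unfolding AP_def by (intro bohr_family_Int bohr_family_almost_periods) auto
    then have "relatively_dense (FV_periods (e/c) \<inter> ?P\<phi> (e/c))"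
      using c \<open>e > 0\<close> bohr_familyD(1)[of _ "e/c"] by simp
    then show ?thesis
    proof (rule relatively_dense_mono, intro subsetI CollectI allI ballI)
      fix \<tau> s t assume \<tau>: "\<tau> \<in> FV_periods (e/c) \<inter> ?P\<phi> (e/c)" and "t \<in> {0..t0}"
      then have t: "0 \<le> t" "t \<le> t0" "t \<le> 1" "s \<le> s + t" using t0(2) by auto
      have X: "\<phi> (s + \<tau>) \<in> X0" "\<phi> s \<in> X0" using apply_bcontfun_in_AP_carrier[OF \<phi>] by auto
      have "norm (\<phi> (s + \<tau>) - \<phi> s) < e/c"
        using \<tau> unfolding almost_periods_def by (simp add: dist_norm)
      then have "P * norm (\<phi> (s + \<tau>) - \<phi> s) \<le> P * (e/c)" using P(1) by (intro mult_left_mono) auto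
      then have 1: "norm (U (s + t) s (\<phi> (s + \<tau>)) - U (s + t) s (\<phi> s)) \<le> P * (e/c)"
        using P(2)[OF t(1,3) subspace_diff[OF subspace_X0 X], of s]
          bounded_linear_on_diff_arg[OF U_bounded_linear[OF t(4)] subspace_X0 X] by simp
      have "norm (U (s + \<tau> + t) (s + \<tau>) (\<phi> (s + \<tau>)) - U (s + t) s (\<phi> (s + \<tau>))) \<le> C * (e/c) * norm (\<phi> (s + \<tau>))"
        using \<tau> by (intro C(2) t X(1)) auto
      also have "\<dots> \<le> C * (e/c) * norm \<phi>"
        using C(1) c \<open>e > 0\<close> by (intro mult_left_mono norm_bounded) auto
      finally have "norm (U (s + \<tau> + t) (s + \<tau>) (\<phi> (s + \<tau>)) - U (s + t) s (\<phi> s)) \<le> C * (e/c) * norm \<phi> + P * (e/c)"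
        using 1 norm_triangle_ineq[of "U (s + \<tau> + t) (s + \<tau>) (\<phi> (s + \<tau>)) - U (s + t) s (\<phi> (s + \<tau>))"
            "U (s + t) s (\<phi> (s + \<tau>)) - U (s + t) s (\<phi> s)"] by simp
      also have "\<dots> = (c - 1) * (e/c)" unfolding c_def by (simp add: algebra_simps flip: add_divide_distrib)
      also have "\<dots> < c * (e/c)" using c \<open>e > 0\<close> by (intro mult_strict_right_mono) auto
      also have "\<dots> = e" using c by simp
      finally show "norm (U (s + \<tau> + t) (s + \<tau>) (\<phi> (s + \<tau>)) - U (s + t) s (\<phi> s)) < e" .
    qed
  qed
  then show thesis using that[OF t0] by blast
qed

text \<open>For short times this is the translation estimate read at the starting time
  \<open>s - t\<close>. Longer times are composed of steps of length at most \<open>t0\<close> by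
  the evolution property.\<close>

lemma evolution_fun_almost_periodic:
  assumes "t \<ge> 0" "\<phi> \<in> AP X0"
  shows "almost_periodic (submetric euclidean_metric X0) (evolution_fun U t \<phi>)"
proof -
  obtain t0 where t0: "0 < t0" "t0 \<le> 1"
    "\<And>\<phi> e. \<phi> \<in> AP X0 \<Longrightarrow> e > 0 \<Longrightarrow>
       relatively_dense {\<tau>. \<forall>s. \<forall>t\<in>{0..t0}.
         norm (U (s + \<tau> + t) (s + \<tau>) (apply_bcontfun \<phi> (s + \<tau>)) - U (s + t) s (apply_bcontfun \<phi> s)) < e}"
    by (rule U_AP_translation) blast
  have small: "almost_periodic (submetric euclidean_metric X0) (evolution_fun U t \<phi>)"
    if t: "t \<in> {0..t0}" and \<phi>: "\<phi> \<in> AP X0" for t \<phi>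
    unfolding almost_periodic_on_iff
  proof (intro conjI allI impI)
    have "continuous_on UNIV (\<lambda>s. case (t, s - t) of (t, s) \<Rightarrow> U (s + t) s (\<phi> s))"
      by (rule continuous_on_compose2[OF continuous_on_U_AP[OF \<phi>]])
        (use t in \<open>auto intro!: continuous_intros\<close>)
    then show "continuous_on UNIV (evolution_fun U t \<phi>)" unfolding evolution_fun_def by simp
    show "range (evolution_fun U t \<phi>) \<subseteq> X0"
      using t apply_bcontfun_in_AP_carrier[OF \<phi>] unfolding evolution_fun_def by (auto intro: U_in_X0)
    fix e :: real assume "e > 0"
    show "relatively_dense {\<tau>. \<forall>s. norm (evolution_fun U t \<phi> (s + \<tau>) - evolution_fun U t \<phi> s) < e}"
    proof (rule relatively_dense_mono[OF t0(3)[OF \<phi> \<open>e > 0\<close>]], safe)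
      fix \<tau> s
      assume "\<forall>s. \<forall>t\<in>{0..t0}. norm (U (s + \<tau> + t) (s + \<tau>) (\<phi> (s + \<tau>)) - U (s + t) s (\<phi> s)) < e"
      then have "norm (U ((s - t) + \<tau> + t) ((s - t) + \<tau>) (\<phi> ((s - t) + \<tau>)) - U ((s - t) + t) (s - t) (\<phi> (s - t))) < e"
        using t by blast
      moreover have "(s - t) + \<tau> = s + \<tau> - t" by simp
      ultimately show "norm (evolution_fun U t \<phi> (s + \<tau>) - evolution_fun U t \<phi> s) < e"
        unfolding evolution_fun_def by simp
    qed
  qed
  \<comment> \<open>Induction on the number of steps, with \<phi> generalised because the hypothesis
    is applied to the function evolved by one short step.\<close>
  have "almost_periodic (submetric euclidean_metric X0) (evolution_fun U t \<phi>)"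
    if "0 \<le> t" "t \<le> real n * t0" "\<phi> \<in> AP X0" for n t \<phi>
    using that
  proof (induction n arbitrary: t \<phi>)
    case 0
    then show ?case using t0(1) by (intro small) auto
  next
    case (Suc n)
    define r where "r = min t t0"
    have r: "r \<in> {0..t0}" "0 \<le> t - r" "t - r \<le> real n * t0"
      using Suc.prems t0(1) unfolding r_def by (auto simp: algebra_simps min_def)
    \<comment> \<open>\<open>Bcontfun\<close> is legitimate here: the short-time result makes the
      function almost periodic, hence bounded.\<close>
    define \<psi> where "\<psi> = Bcontfun (evolution_fun U r \<phi>)"
    have ap: "almost_periodic (submetric euclidean_metric X0) (evolution_fun U r \<phi>)"
      by (rule small[OF r(1) Suc.prems(3)])
    then have \<psi>: "apply_bcontfun \<psi> = evolution_fun U r \<phi>"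
      unfolding \<psi>_def by (simp add: Bcontfun_inverse almost_periodic_imp_bcontfun)
    then have "\<psi> \<in> AP X0" using ap unfolding AP_def by simp
    from Suc.IH[OF r(2,3) this]
    have "almost_periodic (submetric euclidean_metric X0) (evolution_fun U (t - r) \<psi>)" .
    moreover have "evolution_fun U (t - r) \<psi> = evolution_fun U t \<phi>"
      unfolding evolution_fun_def[of U "t - r"] \<psi> unfolding evolution_fun_def
      using r apply_bcontfun_in_AP_carrier[OF Suc.prems(3)] by (auto simp: U_comp intro!: ext)
    ultimately show ?case by simp
  qed
  moreover obtain n :: nat where "t \<le> real n * t0"
    using t0(1) by (meson reals_Archimedean3 less_imp_le)
  ultimately show ?thesis using assms by blast
qed

section \<open>Semigroup laws and strong continuity\<close>

lemma apply_evolution_semigroup: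
  assumes "t \<ge> 0" "\<phi> \<in> AP X0"
  shows "apply_bcontfun (evolution_semigroup U t \<phi>) = evolution_fun U t \<phi>"
  unfolding evolution_semigroup_def
  by (rule Bcontfun_inverse, rule almost_periodic_imp_bcontfun, rule evolution_fun_almost_periodic[OF assms])

lemma evolution_semigroup_in_AP:
  assumes "t \<ge> 0" "\<phi> \<in> AP X0"
  shows "evolution_semigroup U t \<phi> \<in> AP X0"
  using evolution_fun_almost_periodic[OF assms] apply_evolution_semigroup[OF assms]
  unfolding AP_def by simp

lemma bounded_linear_on_evolution_semigroup:
  assumes "t \<ge> 0"
  shows "bounded_linear_on (AP X0) (evolution_semigroup U t)"
  unfolding bounded_linear_on_def linear_op_on_def
proof (intro conjI ballI allI)
  have U: "linear_op_on X0 (U s (s - t))" for s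
    using U_bounded_linear[of "s - t" s] assms unfolding bounded_linear_on_def by simp
  fix \<phi> assume \<phi>: "\<phi> \<in> AP X0"
  show "evolution_semigroup U t (\<phi> + \<psi>) = evolution_semigroup U t \<phi> + evolution_semigroup U t \<psi>"
    if \<psi>: "\<psi> \<in> AP X0" for \<psi>
    using U apply_bcontfun_in_AP_carrier[OF \<phi>] apply_bcontfun_in_AP_carrier[OF \<psi>] unfolding linear_op_on_def
    by (intro bcontfun_eqI)
      (simp add: apply_evolution_semigroup assms \<phi> \<psi> subspace_add[OF subspace_AP[OF subspace_X0]] evolution_fun_def)
  show "evolution_semigroup U t (c *\<^sub>R \<phi>) = c *\<^sub>R evolution_semigroup U t \<phi>" for c
    using U apply_bcontfun_in_AP_carrier[OF \<phi>] unfolding linear_op_on_def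
    by (intro bcontfun_eqI)
      (simp add: apply_evolution_semigroup assms \<phi> subspace_scale[OF subspace_AP[OF subspace_X0]] evolution_fun_def)
next
  obtain M w where M: "M \<ge> 0" "w \<ge> 0"
    "\<And>s t x. s \<le> t \<Longrightarrow> x \<in> X0 \<Longrightarrow> norm (U t s x) \<le> M * exp (w * (t - s)) * norm x"
    by (rule U_exp_bound) blast
  have "norm (evolution_semigroup U t \<phi>) \<le> M * exp (w * t) * norm \<phi>" if \<phi>: "\<phi> \<in> AP X0" for \<phi>
  proof (rule norm_bound)
    fix s
    have "norm (U s (s - t) (\<phi> (s - t))) \<le> M * exp (w * (s - (s - t))) * norm (\<phi> (s - t))"
      using assms apply_bcontfun_in_AP_carrier[OF \<phi>] by (intro M(3)) auto
    also have "\<dots> \<le> M * exp (w * (s - (s - t))) * norm \<phi>"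
      using M(1) by (intro mult_left_mono norm_bounded) auto
    finally show "norm (evolution_semigroup U t \<phi> s) \<le> M * exp (w * t) * norm \<phi>"
      by (simp add: apply_evolution_semigroup assms \<phi> evolution_fun_def)
  qed
  then show "\<exists>C. \<forall>\<phi>\<in>AP X0. norm (evolution_semigroup U t \<phi>) \<le> C * norm \<phi>" by blast
qed

text \<open>Common almost periods reduce the supremum over all starting times \<open>s\<close> to a compact interval.\<close>

lemma evolution_semigroup_tendsto:
  assumes \<phi>: "\<phi> \<in> AP X0"
  shows "((\<lambda>t. evolution_semigroup U t \<phi>) \<longlongrightarrow> \<phi>) (at_right 0)"
proof (rule tendstoI)
  fix e :: real assume "e > 0"
  \<comment> \<open>Indexed by the starting time, so that the semigroup at time \<open>t\<close>,
    evaluated at \<open>s\<close>, is \<open>G t (s - t)\<close>.\<close>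
  define G where "G t s = U (s + t) s (\<phi> s)" for t s
  obtain t0 where t0: "0 < t0" "t0 \<le> 1"
    "\<And>\<phi> e. \<phi> \<in> AP X0 \<Longrightarrow> e > 0 \<Longrightarrow>
       relatively_dense {\<tau>. \<forall>s. \<forall>t\<in>{0..t0}.
         norm (U (s + \<tau> + t) (s + \<tau>) (apply_bcontfun \<phi> (s + \<tau>)) - U (s + t) s (apply_bcontfun \<phi> s)) < e}"
    by (rule U_AP_translation) blast
  have "relatively_dense {\<tau>. \<forall>s. \<forall>t\<in>{0..t0}. norm (G t (s + \<tau>) - G t s) < e/5}"
    using t0(3)[OF \<phi>, of "e/5"] \<open>e > 0\<close> unfolding G_def by simp
  then obtain l where l: "l > 0"
    "\<And>c. {c..c + l} \<inter> {\<tau>. \<forall>s. \<forall>t\<in>{0..t0}. norm (G t (s + \<tau>) - G t s) < e/5} \<noteq> {}"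
    unfolding relatively_dense_def by blast
  have "uniformly_continuous_on ({0..t0} \<times> {0..l}) (\<lambda>(t, s). G t s)"
    unfolding G_def
    by (intro compact_uniformly_continuous continuous_on_subset[OF continuous_on_U_AP[OF \<phi>]] compact_Times) auto
  then obtain d1 where d1: "d1 > 0" "\<And>x y. x \<in> {0..t0} \<times> {0..l} \<Longrightarrow> y \<in> {0..t0} \<times> {0..l} \<Longrightarrow> dist x y < d1 \<Longrightarrow>
      dist (case x of (t, s) \<Rightarrow> G t s) (case y of (t, s) \<Rightarrow> G t s) < e/5"
    by (rule uniformly_continuous_onE[of _ _ "e/5"]) (use \<open>e > 0\<close> in \<open>auto simp: dist_commute\<close>)
  obtain d2 where d2: "d2 > 0" "\<And>s t. \<bar>s - t\<bar> < d2 \<Longrightarrow> norm (\<phi> s - \<phi> t) < e/5"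
    using almost_periodic_uniformly_continuous[of "submetric euclidean_metric X0" "apply_bcontfun \<phi>" "e/5"]
      \<phi> \<open>e > 0\<close> unfolding AP_def by (auto simp: dist_norm)
  show "\<forall>\<^sub>F t in at_right 0. dist (evolution_semigroup U t \<phi>) \<phi> < e"
    unfolding eventually_at_right_field
  proof (intro exI[of _ "min t0 (min d1 d2)"] conjI allI impI)
    fix t :: real assume "0 < t" "t < min t0 (min d1 d2)"
    then have t: "0 < t" "t \<in> {0..t0}" "0 \<in> {0..t0}" "t < d1" "t < d2" by auto
    \<comment> \<open>Two translations into the compact interval, at elapsed times \<open>t\<close>
      and 0, and uniform continuity there cost \<open>e/5\<close> each.\<close>
    have G: "norm (G t r - G 0 r) < 3 * (e/5)" for r
    proof -
      obtain \<tau> where \<tau>: "\<tau> \<in> {-r..-r + l}" "\<And>s t. t \<in> {0..t0} \<Longrightarrow> norm (G t (s + \<tau>) - G t s) < e/5"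
        using l(2)[of "-r"] by blast
      have "dist (case (t, r + \<tau>) of (t, s) \<Rightarrow> G t s) (case (0, r + \<tau>) of (t, s) \<Rightarrow> G t s) < e/5"
        using t \<tau>(1) by (intro d1(2)) (auto simp: dist_Pair_Pair dist_real_def)
      then have "norm (G t (r + \<tau>) - G 0 (r + \<tau>)) < e/5" by (simp add: dist_norm)
      moreover have "norm (G t r - G t (r + \<tau>)) < e/5"
        using \<tau>(2)[OF t(2), of r] by (simp add: norm_minus_commute)
      moreover have "norm (G 0 (r + \<tau>) - G 0 r) < e/5" by (rule \<tau>(2)[OF t(3)])
      ultimately show ?thesis
        using norm_triangle_ineq[of "G t r - G t (r + \<tau>)" "G t (r + \<tau>) - G 0 (r + \<tau>)"]
          norm_triangle_ineq[of "G t r - G 0 (r + \<tau>)" "G 0 (r + \<tau>) - G 0 r"] by simp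
    qed
    \<comment> \<open>The fourth \<open>e/5\<close> pays for moving \<phi> from \<open>s - t\<close>
      to \<open>s\<close>. The fifth is slack: the supremum only inherits a non-strict
      bound.\<close>
    have "dist (evolution_semigroup U t \<phi>) \<phi> \<le> 4 * (e/5)"
    proof (rule dist_bound)
      fix s
      have "evolution_semigroup U t \<phi> s = G t (s - t)"
        using t by (simp add: apply_evolution_semigroup \<phi> evolution_fun_def G_def)
      moreover have "G 0 (s - t) = \<phi> (s - t)" by (simp add: G_def U_refl apply_bcontfun_in_AP_carrier[OF \<phi>])
      moreover have "norm (\<phi> (s - t) - \<phi> s) < e/5" using t by (intro d2(2)) auto
      ultimately show "dist (evolution_semigroup U t \<phi> s) (\<phi> s) \<le> 4 * (e/5)"
        using G[of "s - t"] norm_triangle_ineq[of "G t (s - t) - G 0 (s - t)" "\<phi> (s - t) - \<phi> s"]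
        by (simp add: dist_norm)
    qed
    then show "dist (evolution_semigroup U t \<phi>) \<phi> < e" using \<open>e > 0\<close> by simp
  qed (use t0 d1 d2 in auto)
qed

text \<open>Completeness comes from closedness in the space of bounded continuous functions; the
  semigroup law is the evolution property at the times \<open>r - t - s\<close>,
  \<open>r - t\<close> and \<open>r\<close>.\<close>

lemma C0_semigroup_on_evolution_semigroup: "C0_semigroup_on (AP X0) (evolution_semigroup U)"
  unfolding C0_semigroup_on_def
proof (intro conjI allI impI ballI)
  show "subspace (AP X0)" by (rule subspace_AP[OF subspace_X0])
  show "complete (AP X0)" unfolding complete_eq_closed by (rule closed_AP[OF closed_X0])
  show "evolution_semigroup U 0 \<phi> = \<phi>" if \<phi>: "\<phi> \<in> AP X0" for \<phi>
    by (rule bcontfun_eqI) (simp add: apply_evolution_semigroup evolution_fun_def \<phi> U_refl apply_bcontfun_in_AP_carrier)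
  show "evolution_semigroup U (t + s) \<phi> = evolution_semigroup U t (evolution_semigroup U s \<phi>)"
    if ts: "t \<ge> 0" "s \<ge> 0" and \<phi>: "\<phi> \<in> AP X0" for t s \<phi>
  proof (rule bcontfun_eqI)
    fix r
    have "U r (r - t) (U (r - t) (r - t - s) (\<phi> (r - t - s))) = U r (r - t - s) (\<phi> (r - t - s))"
      using ts by (intro U_comp apply_bcontfun_in_AP_carrier[OF \<phi>]) auto
    then show "evolution_semigroup U (t + s) \<phi> r = evolution_semigroup U t (evolution_semigroup U s \<phi>) r"
      using ts \<phi> evolution_semigroup_in_AP[OF ts(2) \<phi>]
      by (simp add: apply_evolution_semigroup evolution_fun_def diff_diff_eq)
  qed
qed (use evolution_semigroup_in_AP bounded_linear_on_evolution_semigroup evolution_semigroup_tendsto in auto)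

end

text \<open>The first conjunct certifies that \<open>evolution_semigroup\<close> really represents
  \<open>evolution_fun\<close>, so that the second speaks of the intended operators.\<close>

theorem theorem3p4:
  fixes D X0 K :: "'a::banach set"
    and A :: "'a \<Rightarrow> 'a"
    and F V :: "real \<Rightarrow> 'a \<Rightarrow> 'a"
    and U :: "real \<Rightarrow> real \<Rightarrow> 'a \<Rightarrow> 'a"
    and \<omega>A MA :: real
  assumes HY: "hille_yosida D A \<omega>A MA"
    and X0: "X0 = closure D"
    and cone: "positive_cone K"
    and normal: "normal_cone K" "normal_cone (X0 \<inter> K)"
    and generating: "generating_cone UNIV K" "generating_cone X0 (X0 \<inter> K)"
    and F_AP: "almost_periodic (op_metric X0) F"
    and V_AP: "almost_periodic (op_metric X0) V"
    and U_evol: "exp_bounded_evolution_family X0 U"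
    and U_sol: "solution_family D A F V U"
    and resolvent_pos:
      "\<exists>\<omega>. {\<omega><..} \<subseteq> resolvent_set D A \<and> (\<forall>\<mu>>\<omega>. \<forall>x\<in>K. resolvent D A \<mu> x \<in> K)"
    and V_pos: "\<exists>\<mu>>\<omega>A. \<forall>t. \<forall>\<phi>\<in>X0 \<inter> K. \<mu> *\<^sub>R \<phi> - V t \<phi> \<in> K"
    and F_pos: "\<forall>t. \<forall>\<phi>\<in>X0 \<inter> K. F t \<phi> \<in> K"
  shows "(\<forall>t\<ge>0. \<forall>\<phi>\<in>AP X0. evolution_fun U t \<phi> \<in> bcontfun) \<and>
         C0_semigroup_on (AP X0) (evolution_semigroup U)"
proof -
  interpret almost_periodic_evolution D X0 A F V U \<omega>A MA
    using HY X0 F_AP V_AP U_evol U_sol by unfold_locales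
  show ?thesis
    using C0_semigroup_on_evolution_semigroup evolution_fun_almost_periodic almost_periodic_imp_bcontfun
    by blast
qed

end
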